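(* Let $X$ be a $\sigma$-order complete Banach lattice. The following are equivalent: (1) $X$ has the positive Schur property; (2) for every relatively weakly compact net $(x_\alpha)\subset X$, if $x_\alpha\ge 0$ for all $\alpha$ and $x_\alpha\to 0$ weakly, then $\|x_\alpha\|\to 0$; (3) for every sequence $(x_n)\subset X$ and $x\in X$, if $x_n\to x$ weakly and $x_n\xrightarrow{uo}x$, then $\|x_n-x\|\to 0$; (4) for every relatively weakly compact net $(x_\alpha)\subset X$ and $x\in X$, if $x_\alpha\xrightarrow{uo}x$, then $\|x_\alpha-x\|\to 0$; (5) for every sequence $(x_n)\subset X$, if $x_n\ge 0$ for all $n$, $x_n\to 0$ weakly and $x_n\xrightarrow{uo}0$, then $\|x_n\|\to 0$; (6) for every relatively weakly compact net $(x_\alpha)\subset X$, if $x_\alpha\ge 0$ for all $\alpha$ and $x_\alpha\xrightarrow{uo}0$, then $\|x_\alpha\|\to 0$.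
   Context: A vector lattice is $\sigma$-order complete if every countable subset that is order bounded above has a supremum. A Banach lattice $X$ has the positive Schur property if $\|x_n\|\to 0$ for every sequence $(x_n)$ with $x_n\ge 0$ and $x_n\to 0$ weakly. A net is called relatively weakly compact if the set of its members is relatively weakly compact. A net $(x_\alpha)$ in a vector lattice $X$ order converges to $x$ ($x_\alpha\xrightarrow{o}x$) if there is a net $(z_\beta)$ (possibly over a different index set) with $z_\beta\downarrow 0$ such that for every $\beta$ there is $\alpha_0$ with $|x_\alpha-x|\le z_\beta$ for all $\alpha\ge\alpha_0$. The net uo-converges to $x$ ($x_\alpha\xrightarrow{uo}x$) if $|x_\alpha-x|\wedge y\xrightarrow{o}0$ for all $y\in X_+$. *)

theory Defs
  imports "HOL-Analysis.Analysis" "HOL-Library.Lattice_Algebras"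
begin

section \<open>Banach lattices\<close>

class banach_lattice = banach + ordered_real_vector + lattice_ab_group_add_abs +
  assumes norm_abs_mono: "\<bar>x\<bar> \<le> \<bar>y\<bar> \<Longrightarrow> norm x \<le> norm y"

instance real :: banach_lattice
  by standard simp

text \<open>Nonemptiness is required because the empty set is vacuously bounded above, whereas
  a nontrivial vector lattice has no least element.\<close>

definition sigma_order_complete :: "'a::lattice itself \<Rightarrow> bool" where
  "sigma_order_complete _ \<longleftrightarrow>
     (\<forall>A::'a set. countable A \<and> A \<noteq> {} \<and> bdd_above A \<longrightarrow>
        (\<exists>s. (\<forall>a\<in>A. a \<le> s) \<and> (\<forall>u. (\<forall>a\<in>A. a \<le> u) \<longrightarrow> s \<le> u)))"


section \<open>The weak topology\<close>

definition weak_topology :: "'a::real_normed_vector topology" where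
  "weak_topology =
     topology_generated_by {f -` U | (f :: 'a \<Rightarrow> real) U. bounded_linear f \<and> open U}"

definition relatively_weakly_compact :: "'a::real_normed_vector set \<Rightarrow> bool" where
  "relatively_weakly_compact A \<longleftrightarrow> compactin weak_topology (weak_topology closure_of A)"

lemma topspace_weak_topology [simp]:
  "topspace (weak_topology :: 'a::real_normed_vector topology) = UNIV"
proof -
  have "(\<lambda>_::'a. 0::real) -` UNIV \<in> {f -` U | (f :: 'a \<Rightarrow> real) U. bounded_linear f \<and> open U}"
    using bounded_linear_zero open_UNIV by blast
  then show ?thesis
    unfolding weak_topology_def by (auto simp: topology_generated_by_topspace)
qed

lemma limitin_weak_topology_iff:
  "limitin weak_topology x (l :: 'a::real_normed_vector) F \<longleftrightarrow>
     (\<forall>f :: 'a \<Rightarrow> real. bounded_linear f \<longrightarrow> ((\<lambda>i. f (x i)) \<longlongrightarrow> f l) F)"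
proof
  assume L: "limitin weak_topology x l F"
  show "\<forall>f :: 'a \<Rightarrow> real. bounded_linear f \<longrightarrow> ((\<lambda>i. f (x i)) \<longlongrightarrow> f l) F"
  proof (intro allI impI topological_tendstoI)
    fix f :: "'a \<Rightarrow> real" and U
    assume "bounded_linear f" "open U" "f l \<in> U"
    then have "openin weak_topology (f -` U)"
      unfolding weak_topology_def by (intro topology_generated_by_Basis) blast
    then have "eventually (\<lambda>i. x i \<in> f -` U) F"
      using L \<open>f l \<in> U\<close> unfolding limitin_def by blast
    then show "eventually (\<lambda>i. f (x i) \<in> U) F"
      by simp
  qed
next
  assume R: "\<forall>f :: 'a \<Rightarrow> real. bounded_linear f \<longrightarrow> ((\<lambda>i. f (x i)) \<longlongrightarrow> f l) F"
  have "l \<in> V \<longrightarrow> eventually (\<lambda>i. x i \<in> V) F"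
    if "generate_topology_on {f -` U | (f :: 'a \<Rightarrow> real) U. bounded_linear f \<and> open U} V" for V
    using that
  proof induction
    case Empty
    then show ?case by simp
  next
    case (Int a b)
    then show ?case by (auto simp: eventually_conj_iff)
  next
    case (UN K)
    show ?case
    proof
      assume "l \<in> \<Union>K"
      then obtain k where "k \<in> K" "l \<in> k" by blast
      then have "eventually (\<lambda>i. x i \<in> k) F" using UN by blast
      then show "eventually (\<lambda>i. x i \<in> \<Union>K) F"
        by (rule eventually_mono) (use \<open>k \<in> K\<close> in blast)
    qed
  next
    case (Basis s)
    then obtain f :: "'a \<Rightarrow> real" and U where "s = f -` U" "bounded_linear f" "open U"
      by blast
    then show ?case
      using R topological_tendstoD[of "\<lambda>i. f (x i)" "f l" F U] by simp
  qed
  then show "limitin weak_topology x l F"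
    unfolding limitin_def topspace_weak_topology
    by (simp add: weak_topology_def openin_topology_generated_by_iff)
qed

definition positive_Schur_property :: "'a::banach_lattice itself \<Rightarrow> bool" where
  "positive_Schur_property _ \<longleftrightarrow>
     (\<forall>x :: nat \<Rightarrow> 'a. (\<forall>n. 0 \<le> x n) \<and> limitin weak_topology x 0 sequentially \<longrightarrow>
        (\<lambda>n. norm (x n)) \<longlonglongrightarrow> 0)"


section \<open>Nets\<close>

text \<open>A net is a function \<open>x\<close> on a carrier \<open>I\<close>, preordered and directed by \<open>le\<close>. The values
  of \<open>x\<close> and \<open>le\<close> off \<open>I\<close> are irrelevant, and the members of the net form the set \<open>x ` I\<close>.\<close>

definition directed_set :: "'i set \<Rightarrow> ('i \<Rightarrow> 'i \<Rightarrow> bool) \<Rightarrow> bool" where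
  "directed_set I le \<longleftrightarrow> I \<noteq> {} \<and> reflp_on I le \<and> transp_on I le \<and>
     (\<forall>i\<in>I. \<forall>j\<in>I. \<exists>k\<in>I. le i k \<and> le j k)"

definition net_filter :: "'i set \<Rightarrow> ('i \<Rightarrow> 'i \<Rightarrow> bool) \<Rightarrow> 'i filter" where
  "net_filter I le = (INF i\<in>I. principal {j\<in>I. le i j})"

lemma eventually_net_filter:
  assumes "directed_set I le"
  shows "eventually P (net_filter I le) \<longleftrightarrow> (\<exists>i\<in>I. \<forall>j\<in>I. le i j \<longrightarrow> P j)"
  unfolding net_filter_def
proof (subst eventually_INF_base)
  show "I \<noteq> {}" using assms by (simp add: directed_set_def)
next
  fix a b assume "a \<in> I" "b \<in> I"
  then obtain c where "c \<in> I" "le a c" "le b c"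
    using assms by (auto simp: directed_set_def)
  moreover have "transp_on I le" using assms by (simp add: directed_set_def)
  ultimately show "\<exists>c\<in>I. principal {j\<in>I. le c j} \<le> inf (principal {j\<in>I. le a j}) (principal {j\<in>I. le b j})"
    using \<open>a \<in> I\<close> \<open>b \<in> I\<close> by (intro bexI[of _ c]) (auto dest: transp_onD)
qed (auto simp: eventually_principal)

lemma directed_set_nat: "directed_set (UNIV :: nat set) (\<le>)"
  unfolding directed_set_def
  by (auto simp: reflp_on_def transp_on_def intro: max.cobounded1 max.cobounded2)

lemma net_filter_nat: "net_filter (UNIV :: nat set) (\<le>) = sequentially"
  by (simp add: net_filter_def at_top_def atLeast_def)

text \<open>The net \<open>z\<close> on \<open>J\<close> is decreasing with infimum \<open>0\<close>.\<close>

definition net_decreases_to_zero ::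
    "'j set \<Rightarrow> ('j \<Rightarrow> 'j \<Rightarrow> bool) \<Rightarrow> ('j \<Rightarrow> 'a::{order, zero}) \<Rightarrow> bool" where
  "net_decreases_to_zero J leJ z \<longleftrightarrow> directed_set J leJ \<and>
     (\<forall>b\<in>J. \<forall>c\<in>J. leJ b c \<longrightarrow> z c \<le> z b) \<and>
     (\<forall>b\<in>J. 0 \<le> z b) \<and> (\<forall>w. (\<forall>b\<in>J. w \<le> z b) \<longrightarrow> w \<le> 0)"

text \<open>The dominating net \<open>z\<close> may have any index set. Since HOL cannot quantify over types
  inside a definition, its index set is taken inside the type of the lattice; this is no
  restriction, because a decreasing net can be reindexed by its own set of values (lemma
  \<open>order_convergesI\<close>).\<close>

definition order_converges ::
    "'i set \<Rightarrow> ('i \<Rightarrow> 'i \<Rightarrow> bool) \<Rightarrow> ('i \<Rightarrow> 'a::lattice_ab_group_add_abs) \<Rightarrow> 'a \<Rightarrow> bool" where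
  "order_converges I le x l \<longleftrightarrow>
     (\<exists>(J :: 'a set) leJ z. net_decreases_to_zero J leJ z \<and>
        (\<forall>b\<in>J. \<exists>i0\<in>I. \<forall>i\<in>I. le i0 i \<longrightarrow> \<bar>x i - l\<bar> \<le> z b))"

lemma order_convergesI:
  fixes J :: "'j set" and z :: "'j \<Rightarrow> 'a::lattice_ab_group_add_abs"
  assumes z: "net_decreases_to_zero J leJ z"
    and dom: "\<And>b. b \<in> J \<Longrightarrow> \<exists>i0\<in>I. \<forall>i\<in>I. le i0 i \<longrightarrow> \<bar>x i - l\<bar> \<le> z b"
  shows "order_converges I le x l"
proof -
  have dir: "directed_set J leJ" and dec: "\<And>b c. b \<in> J \<Longrightarrow> c \<in> J \<Longrightarrow> leJ b c \<Longrightarrow> z c \<le> z b"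
    using z by (auto simp: net_decreases_to_zero_def)
  have "\<exists>w\<in>z ` J. w \<le> z b \<and> w \<le> z c" if "b \<in> J" "c \<in> J" for b c
  proof -
    obtain d where "d \<in> J" "leJ b d" "leJ c d"
      using dir \<open>b \<in> J\<close> \<open>c \<in> J\<close> unfolding directed_set_def by blast
    then show ?thesis using dec that by blast
  qed
  then have "directed_set (z ` J) (\<lambda>u v. v \<le> u)"
    using dir by (auto simp: directed_set_def reflp_on_def transp_on_def)
  then have "net_decreases_to_zero (z ` J) (\<lambda>u v. v \<le> u) (\<lambda>u. u)"
    using z by (auto simp: net_decreases_to_zero_def)
  moreover have "\<forall>u\<in>z ` J. \<exists>i0\<in>I. \<forall>i\<in>I. le i0 i \<longrightarrow> \<bar>x i - l\<bar> \<le> u"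
    using dom by blast
  ultimately show ?thesis unfolding order_converges_def by blast
qed

definition uo_converges ::
    "'i set \<Rightarrow> ('i \<Rightarrow> 'i \<Rightarrow> bool) \<Rightarrow> ('i \<Rightarrow> 'a::lattice_ab_group_add_abs) \<Rightarrow> 'a \<Rightarrow> bool" where
  "uo_converges I le x l \<longleftrightarrow>
     (\<forall>y\<ge>0. order_converges I le (\<lambda>i. inf \<bar>x i - l\<bar> y) 0)"

text \<open>A sequence is the net indexed by \<open>nat\<close> with its usual order.\<close>

abbreviation uo_converges_seq :: "(nat \<Rightarrow> 'a::lattice_ab_group_add_abs) \<Rightarrow> 'a \<Rightarrow> bool" where
  "uo_converges_seq \<equiv> uo_converges UNIV (\<le>)"

text \<open>HOL cannot quantify over all index sets inside a proposition, so a statement about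
  ``every net'' quantifies over all directed sets contained in a type \<open>'i\<close>, which is a free
  type variable. Where such a statement is to entail a statement about sequences, \<open>'i\<close> has
  to be infinite; an infinite \<open>'i\<close> of arbitrary cardinality accommodates every index set.\<close>

end

theory Submission
  imports Defs
begin

text \<open>Every one of the conditions entails that positive weakly null sequences that are also uo-null are
norm null, and the work lies in deducing the positive Schur property and the assertions about nets
from this uo-version of the Schur property. The deduction goes through two properties that concern
only special sequences.

\<^item> \<^bold>\<open>Order bounded sums\<close> (\<open>order_bounded_sums_null\<close>). If \<open>y n \<ge> 0\<close> and the partial sums of \<open>y\<close> stay
below some \<open>u\<close>, then \<open>norm (y n)\<close> tends to \<open>0\<close>. Such a sequence is weakly null, and in a
\<open>\<sigma>\<close>-order complete lattice it is order null, since it is dominated by the remainders of the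
supremum of its partial sums.

\<^item> \<^bold>\<open>Disjoint Schur property\<close> (\<open>disjoint_positive_Schur_property\<close>). Disjoint positive weakly null
sequences are norm null. A disjoint sequence truncated at \<open>v\<close> has partial sums below \<open>v\<close>, so the
same remark shows that it is uo-null.

The first property makes monotone order bounded sequences norm convergent and turns order null nets
into norm null ones (\<open>net_decreasing_to_zero_norm\<close>). The second makes every relatively weakly
compact set \<open>W\<close> almost order bounded (\<open>relatively_weakly_compact_almost_order_bounded\<close>): for every
\<open>\<epsilon> > 0\<close> some \<open>u \<ge> 0\<close> satisfies \<open>norm (pprt (\<bar>w\<bar> - u)) \<le> \<epsilon>\<close> for all \<open>w \<in> W\<close>. Otherwise one extracts
from \<open>W\<close> a disjoint sequence, dominated by members of \<open>W\<close>, whose norms stay away from \<open>0\<close>; but a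
disjoint sequence dominated by a weakly convergent sequence is weakly null
(\<open>disjoint_dominated_weakly_null\<close>). Since \<open>\<bar>w\<bar> = pprt (\<bar>w\<bar> - u) + inf \<bar>w\<bar> u\<close>, only the truncations
\<open>inf \<bar>w\<bar> u\<close> remain to be estimated. For a uo-convergent net these are order null by definition, hence
norm null. For a positive weakly null sequence they form a sequence in an order interval on which
every positive functional tends to \<open>0\<close>, and such a sequence is norm null
(\<open>order_bounded_positively_null_imp_norm_null\<close>), which yields the positive Schur property.

Finally, the positive Schur property passes from sequences to relatively weakly compact nets, because
a point in the weak closure of a relatively weakly compact set is the weak limit of a sequence from
that set (\<open>weak_closure_sequence\<close>). Norming functionals and separation from closed subspaces come
from a Hahn-Banach theorem for sublinear functionals on real vector spaces.\<close>

section \<open>Sublinear functionals and the Hahn-Banach theorem\<close>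

definition sublinear :: "('a::real_vector \<Rightarrow> real) \<Rightarrow> bool" where
  "sublinear p \<longleftrightarrow> (\<forall>x y. p (x + y) \<le> p x + p y) \<and> (\<forall>a x. 0 \<le> a \<longrightarrow> p (a *\<^sub>R x) = a * p x)"

lemma sublinear_add: "sublinear p \<Longrightarrow> p (x + y) \<le> p x + p y"
  and sublinear_scale: "sublinear p \<Longrightarrow> 0 \<le> a \<Longrightarrow> p (a *\<^sub>R x) = a * p x"
  by (auto simp: sublinear_def)

lemma sublinear_0: "sublinear p \<Longrightarrow> p 0 = 0"
  using sublinear_scale[of p 0 0] by simp

lemma sublinear_minus: "sublinear p \<Longrightarrow> - p (- x) \<le> p x"
  using sublinear_add[of p x "- x"] sublinear_0[of p] by simp

lemma sublinearI:
  assumes add: "\<And>x y. p (x + y) \<le> p x + p y" and zero: "p 0 = 0"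
    and scale: "\<And>a x. 0 < a \<Longrightarrow> p (a *\<^sub>R x) \<le> a * p x"
  shows "sublinear p"
proof -
  have "p (a *\<^sub>R x) = a * p x" if "0 \<le> a" for a x
  proof (cases "a = 0")
    case True
    then show ?thesis using zero by simp
  next
    case False
    then have a: "0 < a" using that by simp
    have "p x = p ((1 / a) *\<^sub>R (a *\<^sub>R x))" using a by simp
    also have "\<dots> \<le> (1 / a) * p (a *\<^sub>R x)" using a by (intro scale) simp
    finally have "a * p x \<le> p (a *\<^sub>R x)" using a by (simp add: field_simps)
    then show ?thesis using scale[OF a, of x] by simp
  qed
  then show ?thesis using add by (auto simp: sublinear_def)
qed

lemma le_INF_add:
  fixes A :: "'s \<Rightarrow> real" and B :: "'t \<Rightarrow> real"
  assumes "S \<noteq> {}" "T \<noteq> {}" and le: "\<And>s t. s \<in> S \<Longrightarrow> t \<in> T \<Longrightarrow> c \<le> A s + B t"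
  shows "c \<le> (INF s\<in>S. A s) + (INF t\<in>T. B t)"
proof -
  have "c - A s \<le> (INF t\<in>T. B t)" if "s \<in> S" for s
    using le[OF that] assms(2) by (intro cINF_greatest) (auto simp: algebra_simps)
  then have "c - (INF t\<in>T. B t) \<le> (INF s\<in>S. A s)"
    using assms(1) by (intro cINF_greatest) (auto simp: algebra_simps)
  then show ?thesis by simp
qed

text \<open>Among the sublinear functionals below \<open>p\<close> that are at most \<open>- p v\<close> at \<open>- v\<close>, the largest is
\<open>q x = (INF t\<ge>0. p (x + t v) - t p v)\<close>. A linear functional below \<open>q\<close> takes the value \<open>p v\<close> at \<open>v\<close>,
and a sublinear \<open>p\<close> that cannot be lowered in this way at any \<open>v\<close> is odd.\<close>

lemma sublinear_lower_at:
  fixes p :: "'a::real_vector \<Rightarrow> real"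
  assumes p: "sublinear p"
  obtains q where "sublinear q" "\<And>x. q x \<le> p x" "q (- v) = - p v"
proof
  define r where "r x t = p (x + t *\<^sub>R v) - t * p v" for x t
  define q where "q x = (INF t\<in>{0..}. r x t)" for x
  have lower: "- p (- x) \<le> r x t" if "0 \<le> t" for x t
    using sublinear_add[OF p, of "x + t *\<^sub>R v" "- x"] sublinear_scale[OF p that, of v]
    by (simp add: r_def)
  have q_le: "q x \<le> r x t" if "0 \<le> t" for x t
    unfolding q_def using that lower by (intro cINF_lower bdd_belowI2[of _ "- p (- x)"]) auto
  have q_ge: "c \<le> q x" if "\<And>t. 0 \<le> t \<Longrightarrow> c \<le> r x t" for c x
    unfolding q_def using that by (intro cINF_greatest) auto
  show le: "q x \<le> p x" for x
    using q_le[of 0 x] by (simp add: r_def)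
  have "q (x + y) \<le> q x + q y" for x y
    unfolding q_def[of x] q_def[of y]
  proof (intro le_INF_add)
    fix s t :: real assume "s \<in> {0..}" "t \<in> {0..}"
    then have "q (x + y) \<le> r (x + y) (s + t)" by (intro q_le) auto
    also have "\<dots> \<le> r x s + r y t"
      using sublinear_add[OF p, of "x + s *\<^sub>R v" "y + t *\<^sub>R v"]
      by (simp add: r_def algebra_simps)
    finally show "q (x + y) \<le> r x s + r y t" .
  qed auto
  moreover have "q 0 = 0"
  proof (rule antisym)
    show "q 0 \<le> 0" using le[of 0] sublinear_0[OF p] by simp
    show "0 \<le> q 0" using sublinear_scale[OF p, of _ v] by (intro q_ge) (simp add: r_def)
  qed
  moreover have "q (a *\<^sub>R x) \<le> a * q x" if "0 < a" for a x
  proof -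
    have "q (a *\<^sub>R x) / a \<le> q x"
    proof (rule q_ge)
      fix t :: real assume "0 \<le> t"
      then have "q (a *\<^sub>R x) \<le> r (a *\<^sub>R x) (a * t)" using that by (intro q_le) auto
      also have "\<dots> = a * r x t"
        using sublinear_scale[OF p, of a "x + t *\<^sub>R v"] that by (simp add: r_def algebra_simps)
      finally show "q (a *\<^sub>R x) / a \<le> r x t" using that by (simp add: field_simps)
    qed
    then show ?thesis using that by (simp add: field_simps)
  qed
  ultimately show sub: "sublinear q" by (rule sublinearI)
  show "q (- v) = - p v"
  proof (rule antisym)
    show "q (- v) \<le> - p v" using q_le[of 1 "- v"] sublinear_0[OF p] by (simp add: r_def)
    show "- p v \<le> q (- v)" using sublinear_minus[OF sub, of "- v"] le[of v] by simp
  qed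
qed

text \<open>Zorn's lemma for the reversed pointwise order: the pointwise infimum of a chain is finite, since
\<open>- p (- x)\<close> bounds it from below, and it is again sublinear, since two members of a chain have a
common lower bound in the chain.\<close>

lemma minimal_sublinear_exists:
  fixes p :: "'a::real_vector \<Rightarrow> real"
  assumes p: "sublinear p"
  obtains m where "sublinear m" "m \<le> p" "\<And>q. sublinear q \<Longrightarrow> q \<le> m \<Longrightarrow> q = m"
proof -
  define A where "A = {q. sublinear q \<and> q \<le> p}"
  have lower: "- p (- x) \<le> q x" if "q \<in> A" for q x
    using sublinear_minus[of q x] that by (auto simp: A_def le_fun_def) (smt (verit))
  have "\<exists>m\<in>A. \<forall>a\<in>A. m \<ge> a \<longrightarrow> a = m"
  proof (rule predicate_Zorn)
    show "partial_order_on A (relation_of (\<ge>) A)"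
      by (auto simp: partial_order_on_def preorder_on_def refl_on_def trans_def antisym_def
          relation_of_def)
  next
    fix C assume "C \<in> Chains (relation_of (\<ge>) A)"
    then have CA: "C \<subseteq> A" and chain: "\<And>q r. q \<in> C \<Longrightarrow> r \<in> C \<Longrightarrow> q \<le> r \<or> r \<le> q"
      by (auto simp: Chains_def relation_of_def)
    show "\<exists>u\<in>A. \<forall>a\<in>C. a \<ge> u"
    proof (cases "C = {}")
      case True
      then show ?thesis using p by (intro bexI[of _ p]) (auto simp: A_def)
    next
      case False
      define u where "u x = (INF q\<in>C. q x)" for x
      have u_le: "u x \<le> q x" if "q \<in> C" for q x
        unfolding u_def using that lower CA
        by (intro cINF_lower bdd_belowI2[of _ "- p (- x)"]) auto
      have u_ge: "c \<le> u x" if "\<And>q. q \<in> C \<Longrightarrow> c \<le> q x" for c x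
        unfolding u_def using that False by (intro cINF_greatest) auto
      have sub: "sublinear q" if "q \<in> C" for q using that CA by (auto simp: A_def)
      have "sublinear u"
      proof (rule sublinearI)
        fix x y
        show "u (x + y) \<le> u x + u y"
          unfolding u_def[of x] u_def[of y]
        proof (intro le_INF_add False)
          fix q r assume "q \<in> C" "r \<in> C"
          then obtain s where s: "s \<in> C" "s \<le> q" "s \<le> r" using chain by blast
          have "u (x + y) \<le> s (x + y)" by (rule u_le[OF s(1)])
          also have "\<dots> \<le> s x + s y" by (rule sublinear_add[OF sub[OF s(1)]])
          also have "\<dots> \<le> q x + r y" using s by (auto simp: le_fun_def intro: add_mono)
          finally show "u (x + y) \<le> q x + r y" .
        qed
      next
        obtain q where "q \<in> C" using False by blast
        then have "u 0 \<le> 0" using u_le[of q 0] sublinear_0[OF sub[of q]] by simp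
        moreover have "0 \<le> u 0" by (rule u_ge) (simp add: sublinear_0[OF sub])
        ultimately show "u 0 = 0" by simp
      next
        fix a :: real and x :: 'a assume a: "0 < a"
        have "u (a *\<^sub>R x) / a \<le> u x"
        proof (rule u_ge)
          fix q assume "q \<in> C"
          then show "u (a *\<^sub>R x) / a \<le> q x"
            using u_le[of q "a *\<^sub>R x"] sublinear_scale[OF sub, of q a x] a
            by (simp add: field_simps)
        qed
        then show "u (a *\<^sub>R x) \<le> a * u x" using a by (simp add: field_simps)
      qed
      moreover have "u \<le> p"
      proof -
        obtain q where "q \<in> C" using False by blast
        then have "u \<le> q" "q \<le> p" using u_le CA by (auto simp: A_def le_fun_def)
        then show ?thesis by (rule order_trans)
      qed
      ultimately show ?thesis using u_le by (intro bexI[of _ u]) (auto simp: A_def le_fun_def)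
    qed
  qed
  then obtain m where "m \<in> A" and min: "\<And>a. a \<in> A \<Longrightarrow> a \<le> m \<Longrightarrow> a = m" by blast
  moreover have "q \<in> A" if "sublinear q" "q \<le> m" for q
    using that \<open>m \<in> A\<close> by (auto simp: A_def)
  ultimately show thesis using that by (auto simp: A_def)
qed

text \<open>A minimal sublinear functional is linear: lowering it in any direction must leave it unchanged, so it
is odd, and an odd sublinear functional is additive. Lowering \<open>p\<close> at \<open>v\<close> before passing to a
minimal functional fixes the value at \<open>v\<close>.\<close>

theorem hahn_banach_sublinear:
  fixes p :: "'a::real_vector \<Rightarrow> real"
  assumes p: "sublinear p"
  obtains g where "linear g" "\<And>x. g x \<le> p x" "g v = p v"
proof -
  obtain p' where p': "sublinear p'" "\<And>x. p' x \<le> p x" "p' (- v) = - p v"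
    using sublinear_lower_at[OF p] by blast
  obtain m where m: "sublinear m" "m \<le> p'" and min: "\<And>q. sublinear q \<Longrightarrow> q \<le> m \<Longrightarrow> q = m"
    using minimal_sublinear_exists[OF p'(1)] by blast
  have odd: "m (- x) = - m x" for x
  proof -
    obtain q where "sublinear q" "\<And>y. q y \<le> m y" "q (- x) = - m x"
      using sublinear_lower_at[OF m(1)] by blast
    then show ?thesis using min[of q] by (auto simp: le_fun_def)
  qed
  have "linear m"
  proof (rule linearI)
    fix x y
    show "m (x + y) = m x + m y"
      using sublinear_add[OF m(1), of x y] sublinear_add[OF m(1), of "- x" "- y"] odd[of x]
        odd[of y] odd[of "x + y"] by (simp add: algebra_simps)
  next
    fix a :: real and x
    show "m (a *\<^sub>R x) = a *\<^sub>R m x"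
      using sublinear_scale[OF m(1), of a x] sublinear_scale[OF m(1), of "- a" x]
        odd[of "a *\<^sub>R x"] by (cases "0 \<le> a") auto
  qed
  moreover have le: "m x \<le> p x" for x
    using m(2) p'(2)[of x] by (auto simp: le_fun_def intro: order_trans)
  moreover have "m v = p v"
    using m(2) p'(3) odd[of v] le[of v] by (auto simp: le_fun_def) (smt (verit))
  ultimately show thesis using that by blast
qed

lemma linear_dominated_abs:
  assumes "linear g" "\<And>x. g x \<le> p x" "\<And>x. p (- x) = p x"
  shows "\<bar>g x\<bar> \<le> (p x :: real)"
  using assms(2)[of x] assms(2)[of "- x"] assms(3)[of x] linear_neg[OF assms(1), of x] by simp

lemma bounded_linear_of_norm_bound:
  fixes g :: "'a::real_normed_vector \<Rightarrow> real"
  assumes "linear g" "\<And>x. \<bar>g x\<bar> \<le> B * norm x"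
  shows "bounded_linear g"
  using assms by (intro bounded_linear.intro bounded_linear_axioms.intro exI[of _ B])
    (auto simp: mult.commute)

lemma norming_functional_exists:
  fixes v :: "'a::real_normed_vector"
  obtains g :: "'a \<Rightarrow> real" where "bounded_linear g" "\<And>x. \<bar>g x\<bar> \<le> norm x" "g v = norm v"
proof -
  have "sublinear (norm :: 'a \<Rightarrow> real)"
    by (simp add: sublinear_def norm_triangle_ineq)
  then obtain g where g: "linear g" "\<And>x. g x \<le> norm x" "g v = norm v"
    using hahn_banach_sublinear by blast
  have "\<bar>g x\<bar> \<le> norm x" for x by (rule linear_dominated_abs[OF g(1,2)]) simp
  with g show thesis
    using that bounded_linear_of_norm_bound[of g 1] by auto
qed

definition norming_functional :: "'a::real_normed_vector \<Rightarrow> 'a \<Rightarrow> real" where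
  "norming_functional v = (SOME g. bounded_linear g \<and> (\<forall>x. \<bar>g x\<bar> \<le> norm x) \<and> g v = norm v)"

lemma norming_functional:
  shows bounded_linear_norming_functional: "bounded_linear (norming_functional v)"
    and abs_norming_functional_le: "\<bar>norming_functional v x\<bar> \<le> norm x"
    and norming_functional_self: "norming_functional v v = norm v"
proof -
  have "\<exists>g. bounded_linear g \<and> (\<forall>x. \<bar>g x\<bar> \<le> norm x) \<and> g v = norm v"
    using norming_functional_exists by blast
  from someI_ex[OF this]
  show "bounded_linear (norming_functional v)" "\<bar>norming_functional v x\<bar> \<le> norm x"
    "norming_functional v v = norm v"
    by (auto simp: norming_functional_def)
qed

lemma norming_functional_diff:
  "norming_functional v (x - y) = norming_functional v x - norming_functional v y"
  by (rule linear_diff[OF bounded_linear.linear[OF bounded_linear_norming_functional]])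

text \<open>The distance to a subspace is sublinear and vanishes exactly on the closure of the subspace, so a
linear functional below it that agrees with it at \<open>v\<close> separates.\<close>

lemma functional_separating_closed_subspace:
  fixes S :: "'a::real_normed_vector set"
  assumes S: "subspace S" "closed S" and v: "v \<notin> S"
  shows "\<exists>g :: 'a \<Rightarrow> real. bounded_linear g \<and> (\<forall>x\<in>S. g x = 0) \<and> g v \<noteq> 0"
proof -
  let ?p = "\<lambda>x. infdist x S"
  have ne: "S \<noteq> {}" using subspace_0[OF S(1)] by blast
  have p_eq: "?p x = (INF s\<in>S. dist x s)" for x
    using ne by (simp add: infdist_def)
  have sub: "sublinear ?p"
  proof (rule sublinearI)
    fix x y
    show "?p (x + y) \<le> ?p x + ?p y"
      unfolding p_eq[of x] p_eq[of y]
    proof (intro le_INF_add ne)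
      fix s t assume "s \<in> S" "t \<in> S"
      then have "?p (x + y) \<le> dist (x + y) (s + t)"
        by (intro infdist_le subspace_add[OF S(1)])
      also have "\<dots> \<le> dist x s + dist y t" by (rule dist_triangle_add)
      finally show "?p (x + y) \<le> dist x s + dist y t" .
    qed
  next
    show "?p 0 = 0" using subspace_0[OF S(1)] by simp
  next
    fix a :: real and x :: 'a assume a: "0 < a"
    have "?p (a *\<^sub>R x) / a \<le> ?p x"
      unfolding p_eq[of x]
    proof (intro cINF_greatest ne)
      fix s assume "s \<in> S"
      then have "?p (a *\<^sub>R x) \<le> dist (a *\<^sub>R x) (a *\<^sub>R s)"
        by (intro infdist_le subspace_scale[OF S(1)])
      also have "\<dots> = a * dist x s" using a by (simp add: dist_norm flip: scaleR_diff_right)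
      finally show "?p (a *\<^sub>R x) / a \<le> dist x s" using a by (simp add: field_simps)
    qed
    then show "?p (a *\<^sub>R x) \<le> a * ?p x" using a by (simp add: field_simps)
  qed
  obtain g where g: "linear g" "\<And>x. g x \<le> ?p x" "g v = ?p v"
    using hahn_banach_sublinear[OF sub] by blast
  have p_minus: "?p (- x) = ?p x" for x
  proof -
    have le: "?p (- x) \<le> ?p x" for x
      unfolding p_eq[of x]
    proof (intro cINF_greatest ne)
      fix s assume "s \<in> S"
      then have "?p (- x) \<le> dist (- x) (- s)" by (intro infdist_le subspace_neg[OF S(1)])
      then show "?p (- x) \<le> dist x s" by (simp add: dist_minus)
    qed
    show ?thesis using le[of x] le[of "- x"] by simp
  qed
  have abs: "\<bar>g x\<bar> \<le> ?p x" for x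
    by (rule linear_dominated_abs[OF g(1,2) p_minus])
  have "bounded_linear g"
  proof (rule bounded_linear_of_norm_bound[OF g(1), of 1])
    fix x
    have "?p x \<le> dist x 0" by (rule infdist_le[OF subspace_0[OF S(1)]])
    then show "\<bar>g x\<bar> \<le> 1 * norm x" using abs[of x] by simp
  qed
  moreover have "g x = 0" if "x \<in> S" for x using abs[of x] that by simp
  moreover have "g v \<noteq> 0" using g(3) v ne S(2) in_closed_iff_infdist_zero by metis
  ultimately show ?thesis by blast
qed

section \<open>Weak closures and relatively weakly compact sets\<close>

lemma openin_weak_vimage:
  fixes f :: "'a::real_normed_vector \<Rightarrow> real"
  assumes "bounded_linear f" "open U"
  shows "openin weak_topology (f -` U)"
  unfolding weak_topology_def using assms by (intro topology_generated_by_Basis) blast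

lemma closure_of_meets:
  "y \<in> T closure_of A \<Longrightarrow> openin T U \<Longrightarrow> y \<in> U \<Longrightarrow> \<exists>a. a \<in> A \<and> a \<in> U"
  by (simp add: in_closure_of)

lemma weak_closure_functional:
  fixes g :: "'a::real_normed_vector \<Rightarrow> real"
  assumes y: "y \<in> weak_topology closure_of A" and g: "bounded_linear g"
    and C: "closed C" "\<And>a. a \<in> A \<Longrightarrow> g a \<in> C"
  shows "g y \<in> C"
proof (rule ccontr)
  assume "g y \<notin> C"
  moreover have "openin weak_topology (g -` (- C))"
    by (rule openin_weak_vimage[OF g open_Compl[OF C(1)]])
  ultimately have "\<exists>a. a \<in> A \<and> a \<in> g -` (- C)"
    by (intro closure_of_meets[OF y]) auto
  then show False using C(2) by auto
qed

lemma weak_cluster_tendsto: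
  fixes g :: "'a::real_normed_vector \<Rightarrow> real" and z :: "nat \<Rightarrow> 'a"
  assumes y: "\<And>k. y \<in> weak_topology closure_of (z ` {k..})" and g: "bounded_linear g"
    and lim: "(\<lambda>n. g (z n)) \<longlonglongrightarrow> c"
  shows "g y = c"
proof -
  have "dist (g y) c \<le> e" if "0 < e" for e
  proof -
    obtain N where N: "\<And>n. n \<ge> N \<Longrightarrow> dist (g (z n)) c < e"
      using lim \<open>0 < e\<close> unfolding lim_sequentially by blast
    have "g y \<in> cball c e"
      using N by (intro weak_closure_functional[OF y[of N] g]) (auto simp: dist_commute less_imp_le)
    then show ?thesis by (simp add: dist_commute)
  qed
  then have "dist (g y) c \<le> 0" by (rule field_le_epsilon) simp
  then show ?thesis by simp
qed

lemma Hausdorff_weak_topology: "Hausdorff_space (weak_topology :: 'a::real_normed_vector topology)"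
  unfolding Hausdorff_space_def
proof (intro allI impI)
  fix x y :: 'a assume "x \<in> topspace weak_topology \<and> y \<in> topspace weak_topology \<and> x \<noteq> y"
  then have "x \<noteq> y" by blast
  let ?g = "norming_functional (x - y)"
  have g: "bounded_linear ?g" by (rule bounded_linear_norming_functional)
  have "?g x - ?g y = norm (x - y)"
    using norming_functional_self[of "x - y"] by (simp add: norming_functional_diff)
  with \<open>x \<noteq> y\<close> have "?g x \<noteq> ?g y" by auto
  then obtain U V where UV: "open U" "open V" "?g x \<in> U" "?g y \<in> V" "U \<inter> V = {}"
    using hausdorff[of "?g x" "?g y"] by blast
  then have "openin weak_topology (?g -` U)" "openin weak_topology (?g -` V)"
    using g by (auto intro: openin_weak_vimage)
  then show "\<exists>U V. openin weak_topology U \<and> openin weak_topology V \<and> x \<in> U \<and> y \<in> V \<and> disjnt U V"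
    using UV by (intro exI[of _ "?g -` U"] exI[of _ "?g -` V"]) (auto simp: disjnt_def)
qed

lemma weak_closure_finite_approx:
  fixes l :: "'a::real_normed_vector" and G :: "('a \<Rightarrow> real) set"
  assumes l: "l \<in> weak_topology closure_of A" and G: "finite G" "\<And>g. g \<in> G \<Longrightarrow> bounded_linear g"
    and e: "0 < e"
  obtains a where "a \<in> A" "\<And>g. g \<in> G \<Longrightarrow> dist (g a) (g l) < e"
proof -
  have "openin weak_topology (\<Inter>g\<in>G. g -` ball (g l) e)"
    using G
  proof (induction G)
    case empty
    then show ?case using openin_topspace[of "weak_topology :: 'a topology"] by simp
  next
    case (insert g G)
    have "openin weak_topology (g -` ball (g l) e)"
      using insert.prems by (intro openin_weak_vimage) auto
    with insert show ?case by (simp add: openin_Int)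
  qed
  moreover have "l \<in> (\<Inter>g\<in>G. g -` ball (g l) e)" using e by auto
  ultimately have "\<exists>a. a \<in> A \<and> a \<in> (\<Inter>g\<in>G. g -` ball (g l) e)"
    by (rule closure_of_meets[OF l])
  then obtain a where "a \<in> A" "a \<in> (\<Inter>g\<in>G. g -` ball (g l) e)" by blast
  then show thesis using that by (auto simp: dist_commute)
qed

text \<open>The weak closures of the tails of the sequence are closed sets with the finite intersection property.\<close>

lemma weak_cluster_point_exists:
  fixes z :: "nat \<Rightarrow> 'a::real_normed_vector"
  assumes W: "relatively_weakly_compact W" and z: "\<And>n. z n \<in> W"
  shows "\<exists>y. \<forall>k. y \<in> weak_topology closure_of (z ` {k..})"
proof -
  let ?T = "weak_topology :: 'a topology"
  let ?C = "\<lambda>k. ?T closure_of (z ` {k..})"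
  have "?T closure_of W \<inter> \<Inter>(range ?C) \<noteq> {}"
  proof -
    have "?T closure_of W \<inter> \<Inter>F \<noteq> {}" if F: "finite F" "F \<subseteq> range ?C" for F
    proof -
      obtain K where K: "finite K" "F = ?C ` K"
        using finite_subset_image[OF F] by auto
      then obtain N where N: "\<And>k. k \<in> K \<Longrightarrow> k \<le> N"
        by (auto simp: finite_nat_set_iff_bounded_le)
      have "z N \<in> ?T closure_of (z ` {k..})" if "k \<in> K" for k
        using N[OF that] closure_of_subset[of "z ` {k..}" ?T] by auto
      moreover have "z N \<in> ?T closure_of W" using z closure_of_subset[of W ?T] by auto
      ultimately show ?thesis using K by blast
    qed
    moreover have "\<forall>C\<in>range ?C. closedin ?T C" by auto
    moreover have "\<forall>\<U>. (\<forall>C\<in>\<U>. closedin ?T C) \<and>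
        (\<forall>F. finite F \<and> F \<subseteq> \<U> \<longrightarrow> ?T closure_of W \<inter> \<Inter>F \<noteq> {}) \<longrightarrow> ?T closure_of W \<inter> \<Inter>\<U> \<noteq> {}"
      using W unfolding relatively_weakly_compact_def compactin_fip by (rule conjunct2)
    ultimately show ?thesis by simp
  qed
  then show ?thesis by auto
qed

lemma relatively_weakly_compact_range:
  assumes "limitin weak_topology x l sequentially"
  shows "relatively_weakly_compact (range x)"
proof -
  let ?K = "insert l (range x)"
  have K: "compactin weak_topology ?K"
    by (rule compactin_sequence_with_limit[OF assms]) auto
  then have "closedin weak_topology ?K"
    by (rule compactin_imp_closedin[OF Hausdorff_weak_topology])
  then have "weak_topology closure_of (range x) \<subseteq> ?K"
    by (intro closure_of_minimal) auto
  then show ?thesis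
    unfolding relatively_weakly_compact_def by (rule closed_compactin[OF K]) simp
qed

lemma not_tendsto_subseq:
  fixes a :: "nat \<Rightarrow> 'b::metric_space"
  assumes "\<not> a \<longlonglongrightarrow> L"
  shows "\<exists>e>0. \<exists>r :: nat \<Rightarrow> nat. strict_mono r \<and> (\<forall>n. e \<le> dist (a (r n)) L)"
proof -
  obtain e where e: "0 < e" "\<And>N. \<exists>n\<ge>N. e \<le> dist (a n) L"
    using assms unfolding lim_sequentially by (auto simp: not_less)
  then have "infinite {n. e \<le> dist (a n) L}"
    by (auto simp: infinite_nat_iff_unbounded_le)
  then obtain r :: "nat \<Rightarrow> nat" where "strict_mono r" "\<And>n. r n \<in> {n. e \<le> dist (a n) L}"
    using infinite_enumerate by blast
  with e(1) show ?thesis by auto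
qed

text \<open>For a constant family \<open>A\<close> this says that sequences suffice to describe the weak closure of a
relatively weakly compact set; the varying sets \<open>A k\<close> serve to extract subsequences.

The points \<open>x k\<close> are chosen successively, so that \<open>x (k + 1) - l\<close> is nearly annihilated by norming
functionals of finitely many combinations of \<open>x 0 - l, \<dots>, x k - l\<close>; these combinations become
dense in the closed span \<open>S\<close> of all \<open>x k - l\<close>. If \<open>y\<close> is a weak cluster point of a
subsequence, then \<open>y - l\<close> belongs to \<open>S\<close>, as closed subspaces are weakly closed, and all these
functionals vanish at \<open>y - l\<close>. But they are norming on a dense subset of \<open>S\<close>, so \<open>y = l\<close>. As every
subsequence has a weak cluster point, the sequence converges weakly to \<open>l\<close>.\<close>

theorem weak_closure_sequence:
  fixes A :: "nat \<Rightarrow> 'a::real_normed_vector set"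
  assumes W: "relatively_weakly_compact W" and AW: "\<And>k. A k \<subseteq> W"
    and l: "\<And>k. l \<in> weak_topology closure_of (A k)"
  shows "\<exists>x. (\<forall>k. x k \<in> A k) \<and> limitin weak_topology x l sequentially"
proof -
  define q where "q = from_nat_into (\<rat> :: real set)"
  have range_q: "range q = \<rat>"
    unfolding q_def using Rats_0 by (intro range_from_nat_into countable_rat) blast
  \<comment> \<open>Iterating this step from a singleton generates a set that is closed under addition and rational multiples, while every stage is finite.\<close>
  define step where "step k V d =
      insert d V \<union> (\<lambda>(a, b). a + b) ` (V \<times> V) \<union> (\<lambda>(i, a). q i *\<^sub>R a) ` ({..k} \<times> V)"
    for k and V :: "'a set" and d
  let ?\<phi> = norming_functional
  have "\<exists>s. \<forall>k. (case s k of (x, V) \<Rightarrow> x \<in> A k \<and> finite V \<and> x - l \<in> V) \<and>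
          (case s k of (x, V) \<Rightarrow> case s (Suc k) of (x', V') \<Rightarrow>
             V' = step k V (x' - l) \<and> (\<forall>v\<in>V. dist (?\<phi> v x') (?\<phi> v l) < 1 / Suc k))"
  proof (rule dependent_nat_choice)
    obtain a where "a \<in> A 0"
      using weak_closure_finite_approx[OF l[of 0], of "{}" 1] by auto
    then show "\<exists>s. case s of (x, V) \<Rightarrow> x \<in> A 0 \<and> finite V \<and> x - l \<in> V"
      by (intro exI[of _ "(a, {a - l})"]) auto
  next
    fix s :: "'a \<times> 'a set" and k
    obtain x V where s: "s = (x, V)" by (cases s)
    assume "case s of (x, V) \<Rightarrow> x \<in> A k \<and> finite V \<and> x - l \<in> V"
    then have V: "finite V" using s by simp
    obtain a where a: "a \<in> A (Suc k)" "\<And>v. v \<in> V \<Longrightarrow> dist (?\<phi> v a) (?\<phi> v l) < 1 / Suc k"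
    proof (rule weak_closure_finite_approx[OF l[of "Suc k"], of "?\<phi> ` V" "1 / Suc k"])
      show "finite (?\<phi> ` V)" using V by simp
    qed (auto simp: bounded_linear_norming_functional)
    have "finite (step k V (a - l))" "a - l \<in> step k V (a - l)"
      using V by (auto simp: step_def)
    with a show "\<exists>s'. (case s' of (x, V) \<Rightarrow> x \<in> A (Suc k) \<and> finite V \<and> x - l \<in> V) \<and>
          (case s of (x, V) \<Rightarrow> case s' of (x', V') \<Rightarrow>
             V' = step k V (x' - l) \<and> (\<forall>v\<in>V. dist (?\<phi> v x') (?\<phi> v l) < 1 / Suc k))"
      unfolding s by (intro exI[of _ "(a, step k V (a - l))"]) auto
  qed
  then obtain s where s: "\<And>k. (case s k of (x, V) \<Rightarrow> x \<in> A k \<and> finite V \<and> x - l \<in> V) \<and>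
          (case s k of (x, V) \<Rightarrow> case s (Suc k) of (x', V') \<Rightarrow>
             V' = step k V (x' - l) \<and> (\<forall>v\<in>V. dist (?\<phi> v x') (?\<phi> v l) < 1 / Suc k))"
    by blast
  define x where "x k = fst (s k)" for k
  define V where "V k = snd (s k)" for k
  have xA: "x k \<in> A k" and xV: "x k - l \<in> V k"
    and V_Suc: "V (Suc k) = step k (V k) (x (Suc k) - l)"
    and small: "\<And>v. v \<in> V k \<Longrightarrow> dist (?\<phi> v (x (Suc k))) (?\<phi> v l) < 1 / Suc k" for k
    using s[of k] by (auto simp: x_def V_def case_prod_beta)
  have V_mono: "V j \<subseteq> V k" if "j \<le> k" for j k
    using that by (induction rule: dec_induct) (auto simp: V_Suc step_def)
  define U where "U = (\<Union>k. V k)"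
  \<comment> \<open>Hence the closure of \<open>U\<close> is a linear subspace, in which \<open>U\<close> is dense by definition.\<close>
  have U_add: "a + b \<in> U" if ab: "a \<in> U" "b \<in> U" for a b
  proof -
    obtain i j where "a \<in> V i" "b \<in> V j" using ab by (auto simp: U_def)
    then have "a \<in> V (max i j)" "b \<in> V (max i j)" using V_mono[of i "max i j"] V_mono[of j "max i j"] by auto
    then have "a + b \<in> V (Suc (max i j))" by (force simp: V_Suc step_def)
    then show ?thesis by (auto simp: U_def)
  qed
  have U_rat: "t *\<^sub>R a \<in> U" if ta: "t \<in> \<rat>" "a \<in> U" for t a
  proof -
    have "t \<in> range q" using ta(1) range_q by simp
    then obtain i where "t = q i" by blast
    obtain j where "a \<in> V j" using ta(2) by (auto simp: U_def)
    then have "a \<in> V (max i j)" using V_mono[of j "max i j"] by auto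
    then have "t *\<^sub>R a \<in> V (Suc (max i j))" using \<open>t = q i\<close> by (force simp: V_Suc step_def)
    then show ?thesis by (auto simp: U_def)
  qed
  define S where "S = closure U"
  have US: "U \<subseteq> S" by (simp add: S_def closure_subset)
  have "subspace S"
  proof (rule subspaceI)
    have "x 0 - l \<in> U" using xV by (auto simp: U_def)
    from U_rat[OF _ this, of 0] US show "0 \<in> S" by auto
  next
    fix a b assume "a \<in> S" "b \<in> S"
    then obtain a' b' where "\<And>n. a' n \<in> U" "a' \<longlonglongrightarrow> a" "\<And>n. b' n \<in> U" "b' \<longlonglongrightarrow> b"
      by (auto simp: S_def closure_sequential)
    then show "a + b \<in> S"
      unfolding S_def closure_sequential
      by (intro exI[of _ "\<lambda>n. a' n + b' n"]) (auto intro: U_add tendsto_add)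
  next
    fix c :: real and a assume a: "a \<in> S"
    have rat: "t *\<^sub>R a \<in> S" if "t \<in> \<rat>" for t
    proof -
      obtain a' where "\<And>n. a' n \<in> U" "a' \<longlonglongrightarrow> a" using a by (auto simp: S_def closure_sequential)
      then show ?thesis
        unfolding S_def closure_sequential
        by (intro exI[of _ "\<lambda>n. t *\<^sub>R a' n"]) (auto intro: U_rat that tendsto_intros)
    qed
    have "closed ((\<lambda>t. t *\<^sub>R a) -` S)"
      unfolding S_def by (intro continuous_closed_vimage continuous_intros) auto
    then have "closure \<rat> \<subseteq> (\<lambda>t. t *\<^sub>R a) -` S"
      using rat by (intro closure_minimal) auto
    moreover have "closure (\<rat> :: real set) = UNIV" by (rule Rats_closure_real)
    ultimately show "c *\<^sub>R a \<in> S" by auto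
  qed
  have "limitin weak_topology x l sequentially"
    unfolding limitin_weak_topology_iff
  proof (intro allI impI)
    fix f :: "'a \<Rightarrow> real" assume f: "bounded_linear f"
    show "(\<lambda>k. f (x k)) \<longlonglongrightarrow> f l"
    proof (rule ccontr)
      assume "\<not> (\<lambda>k. f (x k)) \<longlonglongrightarrow> f l"
      then obtain e and r :: "nat \<Rightarrow> nat" where e: "0 < e" and r: "strict_mono r"
        and far: "\<And>n. e \<le> dist (f (x (r n))) (f l)"
        using not_tendsto_subseq by blast
      have "\<exists>y. \<forall>k. y \<in> weak_topology closure_of ((\<lambda>n. x (r n)) ` {k..})"
      proof (rule weak_cluster_point_exists[OF W])
        show "x (r n) \<in> W" for n using xA AW by blast
      qed
      then obtain y where y: "\<And>k. y \<in> weak_topology closure_of ((\<lambda>n. x (r n)) ` {k..})"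
        by blast
      have yS: "y - l \<in> S"
      proof (rule ccontr)
        assume yl: "y - l \<notin> S"
        have "closed S" by (simp add: S_def)
        obtain g :: "'a \<Rightarrow> real" where g: "bounded_linear g" "\<And>x. x \<in> S \<Longrightarrow> g x = 0" "g (y - l) \<noteq> 0"
          using functional_separating_closed_subspace[OF \<open>subspace S\<close> \<open>closed S\<close> yl] by blast
        have "g (x k) = g l" for k
          using g(2)[of "x k - l"] xV[of k] US linear_diff[OF bounded_linear.linear[OF g(1)]]
          by (auto simp: U_def)
        then have "g y = g l" by (intro weak_cluster_tendsto[OF y g(1)]) auto
        with g(3) show False using linear_diff[OF bounded_linear.linear[OF g(1)]] by simp
      qed
      have \<phi>y: "?\<phi> v (y - l) = 0" if v: "v \<in> U" for v
      proof -
        obtain j where j: "v \<in> V j" using v by (auto simp: U_def)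
        have "(\<lambda>k. ?\<phi> v (x (Suc k))) \<longlonglongrightarrow> ?\<phi> v l"
        proof (rule metric_LIMSEQ_I)
          fix e :: real assume "0 < e"
          then obtain N where N: "1 / Suc N < e" using nat_approx_posE by blast
          have "dist (?\<phi> v (x (Suc k))) (?\<phi> v l) < e" if "k \<ge> max N j" for k
          proof -
            have "v \<in> V k" using j V_mono[of j k] that by auto
            from small[OF this] have "dist (?\<phi> v (x (Suc k))) (?\<phi> v l) < 1 / Suc k" .
            also have "\<dots> \<le> 1 / Suc N" using that by (intro divide_left_mono) auto
            finally show ?thesis using N by simp
          qed
          then show "\<exists>N. \<forall>k\<ge>N. dist (?\<phi> v (x (Suc k))) (?\<phi> v l) < e" by blast
        qed
        then have "(\<lambda>k. ?\<phi> v (x k)) \<longlonglongrightarrow> ?\<phi> v l" by (rule LIMSEQ_imp_Suc)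
        then have "(\<lambda>n. ?\<phi> v (x (r n))) \<longlonglongrightarrow> ?\<phi> v l"
          using LIMSEQ_subseq_LIMSEQ[OF _ r] by (auto simp: o_def)
        from weak_cluster_tendsto[OF y bounded_linear_norming_functional this]
        show ?thesis by (simp add: norming_functional_diff)
      qed
      have "norm (y - l) \<le> e" if "0 < e" for e
      proof -
        obtain v where v: "v \<in> U" "dist v (y - l) < e / 2"
          using yS \<open>0 < e\<close> unfolding S_def closure_approachable by (metis half_gt_zero)
        \<comment> \<open>\<open>v\<close> is close to \<open>y - l\<close>, while its norming functional vanishes at \<open>y - l\<close>; this forces \<open>v\<close>, and with it \<open>y - l\<close>, to be small.\<close>
        have "norm v = ?\<phi> v (v - (y - l))"
          using \<phi>y[OF v(1)] norming_functional_self[of v]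
            norming_functional_diff[of v v "y - l"] by simp
        also have "\<dots> \<le> dist v (y - l)"
          using abs_norming_functional_le[of v "v - (y - l)"] by (simp add: dist_norm)
        finally have "norm v \<le> dist v (y - l)" .
        moreover have "norm (y - l) \<le> norm v + dist v (y - l)"
          using norm_triangle_ineq4[of v "v - (y - l)"] by (simp add: dist_norm)
        ultimately show ?thesis using v(2) by simp
      qed
      then have "norm (y - l) \<le> 0" by (rule field_le_epsilon) simp
      then have "y = l" by simp
      moreover have "f y \<in> - ball (f l) e"
        using far by (intro weak_closure_functional[OF y[of 0] f]) (auto simp: dist_commute not_less)
      ultimately show False using e by simp
    qed
  qed
  with xA show ?thesis by blast
qed

corollary relatively_weakly_compact_subsequence:
  fixes z :: "nat \<Rightarrow> 'a::real_normed_vector"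
  assumes W: "relatively_weakly_compact W" and z: "\<And>n. z n \<in> W"
  obtains l and r :: "nat \<Rightarrow> nat" where "strict_mono r"
    "limitin weak_topology (\<lambda>n. z (r n)) l sequentially"
proof -
  obtain l where l: "\<And>k. l \<in> weak_topology closure_of (z ` {k..})"
    using weak_cluster_point_exists[where z = z, OF W z] by blast
  have "\<exists>x. (\<forall>k. x k \<in> z ` {k..}) \<and> limitin weak_topology x l sequentially"
    using z by (intro weak_closure_sequence[OF W _ l]) auto
  then obtain x where x: "\<And>k. x k \<in> z ` {k..}" "limitin weak_topology x l sequentially"
    by blast
  have "\<exists>n\<ge>k. x k = z n" for k using x(1)[of k] by auto
  then obtain n where n: "\<And>k. n k \<ge> k" "\<And>k. x k = z (n k)" by metis
  have "\<exists>p. \<forall>k. True \<and> n (p k) < n (p (Suc k)) \<and> p k < p (Suc k)"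
  proof (rule dependent_nat_choice)
    fix p k :: nat
    show "\<exists>p'. True \<and> n p < n p' \<and> p < p'"
      using n(1)[of "Suc (max p (n p))"] by (intro exI[of _ "Suc (max p (n p))"]) auto
  qed auto
  then obtain p where p: "\<And>k. n (p k) < n (p (Suc k))" "\<And>k. p k < p (Suc k)" by blast
  have "strict_mono p" "strict_mono (\<lambda>k. n (p k))"
    using p by (auto simp: strict_mono_Suc_iff)
  moreover have "limitin weak_topology (\<lambda>k. z (n (p k))) l sequentially"
    using x(2) LIMSEQ_subseq_LIMSEQ[OF _ \<open>strict_mono p\<close>] n(2)
    by (auto simp: limitin_weak_topology_iff o_def)
  ultimately show thesis using that by blast
qed

lemma bounded_linear_suminf:
  fixes h :: "nat \<Rightarrow> 'a::real_normed_vector \<Rightarrow> real"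
  assumes lin: "\<And>n. linear (h n)" and summ: "\<And>x. summable (\<lambda>n. \<bar>h n x\<bar>)"
    and le: "\<And>x. (\<Sum>n. \<bar>h n x\<bar>) \<le> B * norm x"
  shows "bounded_linear (\<lambda>x. \<Sum>n. h n x)"
proof (rule bounded_linear_of_norm_bound)
  have s: "summable (\<lambda>n. h n x)" for x
    by (rule summable_rabs_cancel[OF summ])
  show "linear (\<lambda>x. \<Sum>n. h n x)"
    by (rule linearI)
      (simp_all add: linear_add[OF lin] linear_scale[OF lin] suminf_add[OF s s] suminf_mult[OF s])
  show "\<bar>\<Sum>n. h n x\<bar> \<le> B * norm x" for x
    using summable_rabs[OF summ, of x] le[of x] by simp
qed

lemma relatively_weakly_compact_functional_bounded:
  fixes f :: "'a::real_normed_vector \<Rightarrow> real"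
  assumes W: "relatively_weakly_compact W" and f: "bounded_linear f"
  shows "bounded (f ` W)"
proof -
  have "continuous_map weak_topology euclideanreal f"
    unfolding continuous_map_def
  proof (intro conjI allI impI)
    fix U :: "real set" assume "openin euclideanreal U"
    then have "openin weak_topology (f -` U)"
      using f by (intro openin_weak_vimage) auto
    then show "openin weak_topology {x \<in> topspace weak_topology. f x \<in> U}"
      by (simp add: vimage_def)
  qed auto
  then have "compactin euclideanreal (f ` (weak_topology closure_of W))"
    using W unfolding relatively_weakly_compact_def by (rule image_compactin[rotated])
  then have "bounded (f ` (weak_topology closure_of W))" by (simp add: compact_imp_bounded)
  moreover have "f ` W \<subseteq> f ` (weak_topology closure_of W)"
    using closure_of_subset[of W weak_topology] by auto
  ultimately show ?thesis by (rule bounded_subset)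
qed

text \<open>The principle of uniform boundedness by a gliding hump. If \<open>norm (w n) > 4 ^ n\<close>, add up the norming
functionals of the points \<open>w n\<close> with coefficients \<open>3 ^ (- n)\<close> up to sign. With the sign of the
\<open>n\<close>-th coefficient chosen so that there is no cancellation at \<open>w n\<close>, the first \<open>n + 1\<close> terms
contribute at least \<open>norm (w n) / 3 ^ n\<close> there, and the remaining ones can undo at most half of it.
So the sum is a bounded functional that is unbounded on \<open>W\<close>.\<close>

lemma relatively_weakly_compact_imp_bounded:
  fixes W :: "'a::real_normed_vector set"
  assumes W: "relatively_weakly_compact W"
  shows "bounded W"
proof (rule ccontr)
  assume "\<not> bounded W"
  then have "\<forall>n. \<exists>w\<in>W. norm w > 4 ^ n" by (meson bounded_iff not_le)
  then obtain w where w: "\<And>n. w n \<in> W" "\<And>n. norm (w n) > 4 ^ n" for n :: nat by metis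
  let ?\<phi> = "\<lambda>n. norming_functional (w n)"
  define s where "s t = (if t \<ge> 0 then 1 else - 1 :: real)" for t :: real
  define F where "F = rec_nat (\<lambda>x. 0) (\<lambda>n G x. G x + s (G (w n)) * (1 / 3) ^ n * ?\<phi> n x)"
  have F_simps: "F 0 x = 0" "F (Suc n) x = F n x + s (F n (w n)) * (1 / 3) ^ n * ?\<phi> n x" for n x
    by (simp_all add: F_def)
  define h where "h n x = s (F n (w n)) * (1 / 3) ^ n * ?\<phi> n x" for n x
  have F_sum: "F n x = (\<Sum>m<n. h m x)" for n x
    by (induction n) (simp_all add: F_simps h_def)
  have h_le: "\<bar>h n x\<bar> \<le> (1 / 3) ^ n * norm x" for n x
    using abs_norming_functional_le[of "w n" x] by (auto simp: h_def s_def abs_mult intro: mult_left_mono)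
  have geo: "summable (\<lambda>n. (1 / 3 :: real) ^ n * norm x)" for x :: 'a
    by (intro summable_mult2 summable_geometric) simp
  have summ: "summable (\<lambda>n. \<bar>h n x\<bar>)" for x
    using h_le by (intro summable_comparison_test'[OF geo[of x], of 0]) auto
  define f where "f x = (\<Sum>n. h n x)" for x
  have "bounded_linear f"
    unfolding f_def
  proof (rule bounded_linear_suminf[OF _ summ])
    show "linear (h n)" for n
      using bounded_linear.linear[OF bounded_linear_norming_functional[of "w n"]]
      by (intro linearI) (auto simp: h_def linear_add linear_scale algebra_simps)
    show "(\<Sum>n. \<bar>h n x\<bar>) \<le> 3 / 2 * norm x" for x
    proof -
      have "(\<Sum>n. \<bar>h n x\<bar>) \<le> (\<Sum>n. (1 / 3) ^ n * norm x)"
        by (intro suminf_le h_le summ geo)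
      also have "\<dots> = 3 / 2 * norm x"
        using suminf_geometric[of "1 / 3 :: real"] by (subst suminf_mult2[symmetric]) auto
      finally show ?thesis .
    qed
  qed
  then have "bounded (f ` W)" by (rule relatively_weakly_compact_functional_bounded[OF W])
  then obtain B where B: "\<And>x. x \<in> W \<Longrightarrow> \<bar>f x\<bar> \<le> B"
    by (auto simp: bounded_iff)
  have "(4 / 3) ^ n / 2 \<le> B" for n
  proof -
    have "F (Suc n) (w n) = F n (w n) + s (F n (w n)) * ((1 / 3) ^ n * norm (w n))"
      by (simp add: F_simps norming_functional_self)
    moreover have "0 \<le> (1 / 3) ^ n * norm (w n)" by simp
    ultimately have big: "(1 / 3) ^ n * norm (w n) \<le> \<bar>F (Suc n) (w n)\<bar>"
      by (auto simp: s_def)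
    have "\<bar>\<Sum>m. h (m + Suc n) (w n)\<bar> \<le> (\<Sum>m. \<bar>h (m + Suc n) (w n)\<bar>)"
      by (intro summable_rabs) (subst summable_iff_shift, rule summ)
    also have "\<dots> \<le> (\<Sum>m. (1 / 3) ^ (m + Suc n) * norm (w n))"
      using summ[of "w n"] geo[of "w n"]
      by (intro suminf_le h_le) (subst summable_iff_shift, assumption)+
    also have "\<dots> = (\<Sum>m. (1 / 3) ^ m) * ((1 / 3) ^ Suc n * norm (w n))"
      by (subst suminf_mult2) (auto simp: power_add mult_ac)
    also have "\<dots> = (1 / 3) ^ n * norm (w n) / 2"
      using suminf_geometric[of "1 / 3 :: real"] by simp
    finally have tail: "\<bar>\<Sum>m. h (m + Suc n) (w n)\<bar> \<le> (1 / 3) ^ n * norm (w n) / 2" .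
    have "f (w n) = (\<Sum>m. h (m + Suc n) (w n)) + F (Suc n) (w n)"
      unfolding f_def F_sum
      by (rule suminf_split_initial_segment) (rule summable_rabs_cancel[OF summ])
    with big tail have "(1 / 3) ^ n * norm (w n) / 2 \<le> \<bar>f (w n)\<bar>" by linarith
    moreover have "(1 / 3) ^ n * 4 ^ n / 2 \<le> (1 / 3) ^ n * norm (w n) / 2"
      using w(2)[of n] by (intro divide_right_mono mult_left_mono) auto
    moreover have "(1 / 3 :: real) ^ n * 4 ^ n = (4 / 3) ^ n"
      by (simp flip: power_mult_distrib)
    ultimately show ?thesis using B[OF w(1)[of n]] by simp
  qed
  moreover obtain n where "2 * B < (4 / 3 :: real) ^ n"
    using real_arch_pow[of "4 / 3" "2 * B"] by auto
  ultimately show False by (smt (verit) field_sum_of_halves)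
qed

text \<open>The hypothesis says that \<open>x \<mapsto> (g n x)\<^sub>n\<close> is a bounded operator into \<open>\<ell>\<^sup>1\<close>, and the conclusion is the
part of Schur's theorem on \<open>\<ell>\<^sup>1\<close> that is needed here. If the diagonal entries \<open>g n (x n)\<close>, with
\<open>x n = w n - l\<close>, did not tend to \<open>0\<close>, one could choose indices \<open>p k\<close> so sparsely that the functional
\<open>f = (\<Sum>k. g (p k))\<close> is dominated at \<open>x (p k)\<close> by its \<open>k\<close>-th term: earlier terms are small there
because \<open>x\<close> is weakly null, later ones because the series converges. Then \<open>f (x (p k))\<close> does not tend
to \<open>0\<close>.\<close>

lemma weakly_null_diagonal:
  fixes g :: "nat \<Rightarrow> 'a::real_normed_vector \<Rightarrow> real" and w :: "nat \<Rightarrow> 'a"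
  assumes lin: "\<And>n. linear (g n)" and le: "\<And>n x. (\<Sum>m<n. \<bar>g m x\<bar>) \<le> B * norm x"
    and lim: "limitin weak_topology w l sequentially"
  shows "(\<lambda>n. g n (w n)) \<longlonglongrightarrow> 0"
proof -
  have summ: "summable (\<lambda>n. \<bar>g n x\<bar>)" for x
    using le by (intro bounded_imp_summable[of _ "B * norm x"])
      (auto simp: lessThan_Suc_atMost[symmetric] simp del: sum.lessThan_Suc)
  have total_le: "(\<Sum>n. \<bar>g n x\<bar>) \<le> B * norm x" for x
    by (intro suminf_le_const summ le)
  define x where "x n = w n - l" for n
  have weak: "(\<lambda>n. f (x n)) \<longlonglongrightarrow> 0" if f: "bounded_linear f" for f :: "'a \<Rightarrow> real"
  proof -
    have "(\<lambda>n. f (w n) - f l) \<longlonglongrightarrow> f l - f l"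
      using lim f by (intro tendsto_intros) (auto simp: limitin_weak_topology_iff)
    then show ?thesis by (simp add: x_def linear_diff[OF bounded_linear.linear[OF f]])
  qed
  have g_bl: "bounded_linear (g n)" for n
  proof (rule bounded_linear_of_norm_bound[OF lin])
    show "\<bar>g n x\<bar> \<le> B * norm x" for x
    proof -
      have "0 \<le> (\<Sum>m<n. \<bar>g m x\<bar>)" by (simp add: sum_nonneg)
      then show ?thesis using le[of x "Suc n"] unfolding sum.lessThan_Suc by linarith
    qed
  qed
  have "(\<lambda>n. g n (x n)) \<longlonglongrightarrow> 0"
  proof (rule ccontr)
    assume "\<not> (\<lambda>n. g n (x n)) \<longlonglongrightarrow> 0"
    then obtain e and r :: "nat \<Rightarrow> nat" where e: "0 < e" and r: "strict_mono r"
      and far: "\<And>n. e \<le> \<bar>g (r n) (x (r n))\<bar>"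
      using not_tendsto_subseq[of "\<lambda>n. g n (x n)" 0] by (auto simp: dist_norm)
    define tail where "tail y n = (\<Sum>m. \<bar>g (m + n) y\<bar>)" for y n
    have tail_lim: "tail y \<longlonglongrightarrow> 0" for y
      unfolding tail_def by (rule suminf_exist_split2[OF summ])
    have "\<exists>p. \<forall>k. e \<le> \<bar>g (p k) (x (p k))\<bar> \<and>
        (p k < p (Suc k) \<and> (\<Sum>m\<le>p k. \<bar>g m (x (p (Suc k)))\<bar>) < e / 4 \<and>
         tail (x (p k)) (p (Suc k)) < e / 4)"
    proof (rule dependent_nat_choice)
      show "\<exists>p. e \<le> \<bar>g p (x p)\<bar>" using far by blast
    next
      fix p :: nat
      have "(\<lambda>n. \<Sum>m\<le>p. \<bar>g m (x n)\<bar>) \<longlonglongrightarrow> (\<Sum>m\<le>p. 0)"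
        by (intro tendsto_sum tendsto_rabs_zero weak g_bl)
      then have "\<forall>\<^sub>F n in sequentially. (\<Sum>m\<le>p. \<bar>g m (x n)\<bar>) < e / 4"
        using e by (intro order_tendstoD) auto
      moreover have "\<forall>\<^sub>F n in sequentially. tail (x p) n < e / 4"
        using tail_lim e by (intro order_tendstoD) auto
      ultimately have "\<forall>\<^sub>F n in sequentially.
          (\<Sum>m\<le>p. \<bar>g m (x n)\<bar>) < e / 4 \<and> tail (x p) n < e / 4"
        by (rule eventually_conj)
      then obtain N where N: "\<And>n. n \<ge> N \<Longrightarrow>
          (\<Sum>m\<le>p. \<bar>g m (x n)\<bar>) < e / 4 \<and> tail (x p) n < e / 4"
        unfolding eventually_sequentially by auto
      let ?n = "r (max N (Suc p))"
      have "?n \<ge> max N (Suc p)" using r by (rule seq_suble)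
      then show "\<exists>n. e \<le> \<bar>g n (x n)\<bar> \<and>
          (p < n \<and> (\<Sum>m\<le>p. \<bar>g m (x n)\<bar>) < e / 4 \<and> tail (x p) n < e / 4)"
        using far N[of ?n] by (intro exI[of _ ?n]) auto
    qed
    then obtain p where p: "\<And>k. e \<le> \<bar>g (p k) (x (p k))\<bar>" "\<And>k. p k < p (Suc k)"
        "\<And>k. (\<Sum>m\<le>p k. \<bar>g m (x (p (Suc k)))\<bar>) < e / 4"
        "\<And>k. tail (x (p k)) (p (Suc k)) < e / 4"
      by blast
    have mono: "strict_mono p" using p(2) by (simp add: strict_mono_Suc_iff)
    define h where "h n y = (if n \<in> range p then g n y else 0)" for n y
    have h_le: "\<bar>h n y\<bar> \<le> \<bar>g n y\<bar>" for n y by (simp add: h_def)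
    have h_summ: "summable (\<lambda>n. \<bar>h n y\<bar>)" for y
      using h_le by (intro summable_comparison_test'[OF summ[of y], of 0]) auto
    define f where "f y = (\<Sum>n. h n y)" for y
    have "bounded_linear f"
      unfolding f_def
    proof (rule bounded_linear_suminf[OF _ h_summ])
      show "linear (h n)" for n
        by (cases "n \<in> range p") (auto simp: h_def[abs_def] lin intro: linear_zero)
      show "(\<Sum>n. \<bar>h n y\<bar>) \<le> B * norm y" for y
        using suminf_le[OF h_le h_summ summ, of y] total_le[of y] by simp
    qed
    from weak[OF this] have "(\<lambda>n. f (x (p (Suc n)))) \<longlonglongrightarrow> 0"
      using LIMSEQ_subseq_LIMSEQ[of "\<lambda>n. f (x n)" 0 "\<lambda>n. p (Suc n)"] mono
      by (auto simp: o_def strict_mono_def)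
    then have "\<forall>\<^sub>F k in sequentially. \<bar>f (x (p (Suc k)))\<bar> < e / 2"
      using e by (auto intro!: order_tendstoD(2) tendsto_rabs_zero)
    then obtain k where small: "\<bar>f (x (p (Suc k)))\<bar> < e / 2"
      using eventually_sequentially by auto
    \<comment> \<open>At \<open>x b\<close> the terms up to \<open>a\<close> and those from \<open>c\<close> on are small, and \<open>b\<close> is the only index of \<open>f\<close> in between.\<close>
    define a b c where "a = p k" and "b = p (Suc k)" and "c = p (Suc (Suc k))"
    have ab: "a < b" and bc: "b < c" using p(2) by (auto simp: a_def b_def c_def)
    have gap: "n = b" if "n \<in> range p" "a < n" "n < c" for n
    proof -
      obtain j where j: "n = p j" using \<open>n \<in> range p\<close> by blast
      then have "k < j" "j < Suc (Suc k)"
        using that mono by (auto simp: a_def c_def strict_mono_less)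
      then have "j = Suc k" by simp
      then show ?thesis using j by (simp add: b_def)
    qed
    have "f (x b) = (\<Sum>n. h (n + c) (x b)) + (\<Sum>n<c. h n (x b))"
      unfolding f_def
      by (rule suminf_split_initial_segment) (rule summable_rabs_cancel[OF h_summ])
    moreover have "(\<Sum>n<c. h n (x b)) = (\<Sum>n\<le>a. h n (x b)) + h b (x b)"
    proof -
      have "(\<Sum>n<c. h n (x b)) = (\<Sum>n\<in>insert b {..a}. h n (x b))"
        using ab bc gap by (intro sum.mono_neutral_right) (auto simp: h_def)
      also have "\<dots> = (\<Sum>n\<le>a. h n (x b)) + h b (x b)" using ab by (subst sum.insert) auto
      finally show ?thesis .
    qed
    moreover have "\<bar>\<Sum>n. h (n + c) (x b)\<bar> < e / 4"
    proof -
      have "\<bar>\<Sum>n. h (n + c) (x b)\<bar> \<le> (\<Sum>n. \<bar>h (n + c) (x b)\<bar>)"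
        by (intro summable_rabs) (subst summable_iff_shift, rule h_summ)
      also have "\<dots> \<le> tail (x b) c"
        unfolding tail_def using h_summ[of "x b"] summ[of "x b"]
        by (intro suminf_le h_le) (subst summable_iff_shift, assumption)+
      also have "\<dots> < e / 4" using p(4)[of "Suc k"] by (simp add: b_def c_def)
      finally show ?thesis .
    qed
    moreover have "\<bar>\<Sum>n\<le>a. h n (x b)\<bar> < e / 4"
    proof -
      have "\<bar>\<Sum>n\<le>a. h n (x b)\<bar> \<le> (\<Sum>n\<le>a. \<bar>g n (x b)\<bar>)"
        using h_le by (intro order_trans[OF sum_abs] sum_mono) auto
      also have "\<dots> < e / 4" using p(3)[of k] by (simp add: a_def b_def)
      finally show ?thesis .
    qed
    moreover have "e \<le> \<bar>h b (x b)\<bar>" using p(1)[of "Suc k"] by (auto simp: h_def b_def)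
    ultimately show False using small unfolding b_def by linarith
  qed
  moreover have "(\<lambda>n. g n l) \<longlonglongrightarrow> 0"
    using summable_LIMSEQ_zero[OF summ[of l]] by (rule tendsto_rabs_zero_cancel)
  ultimately have "(\<lambda>n. g n (x n) + g n l) \<longlonglongrightarrow> 0 + 0" by (rule tendsto_add)
  then show ?thesis by (simp add: x_def linear_diff[OF lin])
qed

section \<open>Vector lattice arithmetic\<close>

lemma norm_abs_lattice [simp]: "norm \<bar>x\<bar> = norm (x :: 'a::banach_lattice)"
  by (intro antisym norm_abs_mono) auto

lemma norm_mono_nonneg: "0 \<le> x \<Longrightarrow> x \<le> y \<Longrightarrow> norm x \<le> norm (y :: 'a::banach_lattice)"
  by (rule norm_abs_mono) (simp add: abs_of_nonneg)

lemma scaleR_inf: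
  fixes a b :: "'a::banach_lattice"
  assumes "0 \<le> c"
  shows "c *\<^sub>R inf a b = inf (c *\<^sub>R a) (c *\<^sub>R b)"
proof (cases "c = 0")
  case False
  then have c: "0 < c" using assms by simp
  show ?thesis
  proof (rule antisym)
    show "c *\<^sub>R inf a b \<le> inf (c *\<^sub>R a) (c *\<^sub>R b)"
      using assms by (intro le_infI scaleR_left_mono) auto
    have "(1 / c) *\<^sub>R inf (c *\<^sub>R a) (c *\<^sub>R b) \<le> (1 / c) *\<^sub>R (c *\<^sub>R a)"
      "(1 / c) *\<^sub>R inf (c *\<^sub>R a) (c *\<^sub>R b) \<le> (1 / c) *\<^sub>R (c *\<^sub>R b)"
      using c by (intro scaleR_left_mono; simp)+
    then have "(1 / c) *\<^sub>R inf (c *\<^sub>R a) (c *\<^sub>R b) \<le> inf a b" using c by simp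
    then have "c *\<^sub>R ((1 / c) *\<^sub>R inf (c *\<^sub>R a) (c *\<^sub>R b)) \<le> c *\<^sub>R inf a b"
      using assms by (rule scaleR_left_mono)
    then show "inf (c *\<^sub>R a) (c *\<^sub>R b) \<le> c *\<^sub>R inf a b" using c by simp
  qed
qed simp

lemma scaleR_sup:
  fixes a b :: "'a::banach_lattice"
  assumes "0 \<le> c"
  shows "c *\<^sub>R sup a b = sup (c *\<^sub>R a) (c *\<^sub>R b)"
  using scaleR_inf[OF assms, of "- a" "- b"] by (simp flip: neg_sup_eq_inf)

lemma scaleR_pprt:
  fixes a :: "'a::banach_lattice"
  assumes "0 \<le> c"
  shows "c *\<^sub>R pprt a = pprt (c *\<^sub>R a)"
  by (simp add: pprt_def scaleR_sup[OF assms])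

lemma abs_scaleR_nonneg:
  fixes a :: "'a::banach_lattice"
  assumes "0 \<le> c"
  shows "\<bar>c *\<^sub>R a\<bar> = c *\<^sub>R \<bar>a\<bar>"
  by (simp add: abs_lattice scaleR_sup[OF assms])

lemma inf_add_le:
  fixes a b c :: "'a::lattice_ab_group_add"
  assumes "0 \<le> a" "0 \<le> b" "0 \<le> c"
  shows "inf a (b + c) \<le> inf a b + inf a c"
proof -
  have "inf a (b + c) \<le> a + a" "inf a (b + c) \<le> a + c" "inf a (b + c) \<le> b + a"
    using assms by (auto intro: le_infI1 add_increasing add_increasing2)
  then show ?thesis by (simp add: add_inf_distrib_left add_inf_distrib_right)
qed

lemma nonneg_member_le_sum:
  fixes f :: "'i \<Rightarrow> 'a::ordered_comm_monoid_add"
  assumes "i \<in> F" "finite F" "\<And>j. j \<in> F \<Longrightarrow> 0 \<le> f j"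
  shows "f i \<le> sum f F"
  using sum_mono2[of F "{i}" f] assms by simp

lemma disjoint_mono:
  fixes a b :: "'a::lattice_ab_group_add"
  assumes "inf a b = 0" "0 \<le> a'" "a' \<le> a" "0 \<le> b'" "b' \<le> b"
  shows "inf a' b' = 0"
  using inf_mono[OF assms(3,5)] assms by (intro antisym) auto

lemma disjoint_scaleR:
  fixes a b :: "'a::banach_lattice"
  assumes "inf a b = 0" "0 \<le> c" "0 \<le> d"
  shows "inf (c *\<^sub>R a) (d *\<^sub>R b) = 0"
proof -
  have nn: "0 \<le> a" "0 \<le> b" using assms(1) inf_le1[of a b] inf_le2[of a b] by simp_all
  have "inf (max c d *\<^sub>R a) (max c d *\<^sub>R b) = 0"
    using scaleR_inf[of "max c d" a b] assms by simp
  then show ?thesis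
    by (rule disjoint_mono) (use nn assms(2,3) in \<open>auto intro: scaleR_right_mono scaleR_nonneg_nonneg\<close>)
qed

lemma disjoint_sum:
  fixes b :: "'i \<Rightarrow> 'a::lattice_ab_group_add"
  assumes "finite F" "0 \<le> a" "\<And>i. i \<in> F \<Longrightarrow> 0 \<le> b i" "\<And>i. i \<in> F \<Longrightarrow> inf a (b i) = 0"
  shows "inf a (\<Sum>i\<in>F. b i) = 0"
  using assms
proof (induction F rule: finite_induct)
  case empty
  then show ?case by (simp add: inf.absorb2)
next
  case (insert i F)
  have nn: "0 \<le> (\<Sum>i\<in>F. b i)" using insert.prems by (intro sum_nonneg) auto
  have "inf a (b i + (\<Sum>i\<in>F. b i)) \<le> inf a (b i) + inf a (\<Sum>i\<in>F. b i)"
    using insert.prems nn by (intro inf_add_le) auto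
  also have "\<dots> = 0" using insert by simp
  finally show ?case using insert nn by (intro antisym) auto
qed

lemma disjoint_sum_le:
  fixes a :: "'i \<Rightarrow> 'a::lattice_ab_group_add"
  assumes "finite F" "0 \<le> z" "\<And>i. i \<in> F \<Longrightarrow> 0 \<le> a i \<and> a i \<le> z"
    and "\<And>i j. i \<in> F \<Longrightarrow> j \<in> F \<Longrightarrow> i \<noteq> j \<Longrightarrow> inf (a i) (a j) = 0"
  shows "(\<Sum>i\<in>F. a i) \<le> z"
  using assms
proof (induction F rule: finite_induct)
  case (insert i F)
  have "inf (a i) (\<Sum>i\<in>F. a i) = 0"
    using insert.hyps insert.prems by (intro disjoint_sum) auto
  then have "a i + (\<Sum>i\<in>F. a i) = sup (a i) (\<Sum>i\<in>F. a i)"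
    using add_eq_inf_sup[of "a i" "\<Sum>i\<in>F. a i"] by simp
  also have "\<dots> \<le> z" using insert.IH insert.prems by (intro le_supI) simp_all
  finally show ?case using insert.hyps by simp
qed simp

lemma pprt_diff: "pprt (a - b) = a - inf a (b :: 'a::lattice_ab_group_add)"
proof -
  have "a - inf a b = a + sup (- a) (- b)" by (rule diff_inf_eq_sup)
  also have "\<dots> = sup (a + - a) (a + - b)" by (rule add_sup_distrib_left)
  finally show ?thesis by (simp add: pprt_def sup.commute[of _ 0])
qed

lemma pprt_diff_disjoint: "inf (pprt (a - b)) (pprt (b - a)) = (0 :: 'a::lattice_ab_group_add)"
proof -
  have "inf (a - m) (b - m) = inf a b - m" for m
    using add_inf_distrib_right[of a b "- m"] by simp
  from this[of "inf a b"] show ?thesis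
    unfolding pprt_diff inf_commute[of b a] diff_self .
qed

lemma pprt_le_pprt_diff_add:
  fixes a b :: "'a::lattice_ab_group_add"
  assumes "0 \<le> b"
  shows "pprt a \<le> pprt (a - b) + b"
proof -
  have "a \<le> pprt (a - b) + b" unfolding pprt_def by (simp flip: diff_le_eq)
  moreover have "0 \<le> pprt (a - b) + b" using assms by simp
  ultimately show ?thesis by (simp add: pprt_def)
qed

text \<open>The first summand is \<open>y\<close> cut off at \<open>a\<close> and \<open>- a\<close>. The last two bounds say that both summands stay
in every order interval \<open>{- c..c}\<close> that contains \<open>y\<close>.\<close>

lemma Riesz_decomposition:
  fixes y :: "'a::lattice_ab_group_add_abs"
  assumes le: "\<bar>y\<bar> \<le> a + b" and nn: "0 \<le> a" "0 \<le> b"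
  obtains y1 y2 where "y = y1 + y2" "\<bar>y1\<bar> \<le> a" "\<bar>y2\<bar> \<le> b" "\<bar>y1\<bar> \<le> \<bar>y\<bar>" "\<bar>y2\<bar> \<le> \<bar>y\<bar>"
proof
  define y1 where "y1 = sup (inf y a) (- a)"
  define y2 where "y2 = y - y1"
  have y: "y \<le> \<bar>y\<bar>" "- y \<le> \<bar>y\<bar>" "- \<bar>y\<bar> \<le> y"
    using abs_ge_self[of y] abs_ge_minus_self[of y] by (auto simp: minus_le_iff)
  have yab: "y \<le> a + b" "- y \<le> a + b" using y le by (auto intro: order_trans)
  have neg: "- \<bar>y\<bar> \<le> 0" by simp
  have na: "- a \<le> 0" using nn by simp
  show "y = y1 + y2" by (simp add: y2_def)
  have "y1 \<le> a" "- a \<le> y1"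
    unfolding y1_def using na order_trans[OF na nn(1)] by auto
  then show "\<bar>y1\<bar> \<le> a" by (intro abs_leI) (auto simp: minus_le_iff)
  have "y1 \<le> \<bar>y\<bar>"
    unfolding y1_def using y(1) na by (auto intro: le_infI1 order_trans[OF na])
  moreover have "- \<bar>y\<bar> \<le> y1"
    unfolding y1_def using y(3) order_trans[OF neg nn(1)] by (intro le_supI1 le_infI)
  ultimately show "\<bar>y1\<bar> \<le> \<bar>y\<bar>" by (intro abs_leI) (auto simp: minus_le_iff)
  have "y2 \<le> y - inf y a" unfolding y2_def y1_def by (intro diff_left_mono) simp
  also have "\<dots> = sup (y - a) 0" using pprt_diff[of y a] unfolding pprt_def by (rule sym)
  finally have up: "y2 \<le> sup (y - a) 0" .
  have "- y2 = sup (inf y a - y) (- a - y)"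
    using add_sup_distrib_right[of "inf y a" "- a" "- y"] by (simp add: y2_def y1_def)
  also have "\<dots> \<le> sup 0 (- a - y)" by (intro sup_mono) auto
  finally have dn: "- y2 \<le> sup 0 (- a - y)" .
  have 1: "y - a \<le> b" "- a - y \<le> b"
    using add_left_mono[OF yab(1), of "- a"] add_left_mono[OF yab(2), of "- a"] by simp_all
  have 2: "y - a \<le> \<bar>y\<bar>" "- a - y \<le> \<bar>y\<bar>"
    using add_mono[OF y(1) na] add_mono[OF na y(2)] by simp_all
  show "\<bar>y2\<bar> \<le> b"
    using 1 nn by (intro abs_leI order_trans[OF up] order_trans[OF dn]) auto
  show "\<bar>y2\<bar> \<le> \<bar>y\<bar>"
    using 2 by (intro abs_leI order_trans[OF up] order_trans[OF dn]) auto
qed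

lemma pprt_minus_le:
  fixes x y :: "'a::lattice_ab_group_add_abs"
  assumes "0 \<le> y"
  shows "pprt (- x) \<le> \<bar>y - x\<bar>"
proof -
  have "- x \<le> y - x" using assms by simp
  also have "\<dots> \<le> \<bar>y - x\<bar>" by (rule abs_ge_self)
  finally show ?thesis by (simp add: pprt_def)
qed

text \<open>The negative part of \<open>l\<close> is dominated by \<open>\<bar>x n - l\<bar>\<close>, because \<open>x n\<close> is positive.\<close>

lemma lim_nonneg:
  fixes x :: "nat \<Rightarrow> 'a::banach_lattice"
  assumes "x \<longlonglongrightarrow> l" "\<And>n. 0 \<le> x n"
  shows "0 \<le> l"
proof -
  have "norm (pprt (- l)) \<le> norm (x n - l)" for n
    using norm_mono_nonneg[OF _ pprt_minus_le[OF assms(2)], of l n] by simp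
  moreover have "(\<lambda>n. norm (x n - l)) \<longlonglongrightarrow> 0"
    using assms(1) by (simp add: LIM_zero tendsto_norm_zero)
  ultimately have "norm (pprt (- l)) \<le> 0" by (intro LIMSEQ_le_const) auto
  then have "pprt (- l) = 0" by simp
  then show ?thesis using le_zero_iff_zero_pprt[of "- l"] by simp
qed

lemma lim_mono_lattice:
  fixes x y :: "nat \<Rightarrow> 'a::banach_lattice"
  assumes "x \<longlonglongrightarrow> l" "y \<longlonglongrightarrow> m" "\<And>n. x n \<le> y n"
  shows "l \<le> m"
  using lim_nonneg[OF tendsto_diff[OF assms(2,1)]] assms(3) by simp

section \<open>Almost order boundedness of relatively weakly compact sets\<close>

text \<open>Let \<open>f\<close> be a functional with \<open>\<bar>f x\<bar> \<le> B * norm x\<close>. Together with \<open>v n\<close> it defines the seminorm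
\<open>p n x = (SUP y. f y)\<close>, where \<open>y\<close> ranges over the elements with \<open>\<bar>y\<bar> \<le> \<bar>x\<bar>\<close> that are bounded by a
multiple of \<open>v n\<close>; it is the supremum over \<open>k\<close> of the values of the modulus of \<open>f\<close> at
\<open>inf \<bar>x\<bar> (k v n)\<close>, and subadditive by Riesz decomposition. By disjointness of the \<open>v n\<close>, elements \<open>y\<close> chosen for finitely many \<open>n\<close> have a sum that is still
bounded by \<open>\<bar>x\<bar>\<close>, so \<open>(\<Sum>n. p n x) \<le> B * norm x\<close>. Since \<open>v n\<close> is a candidate for \<open>y\<close> at \<open>x = w n\<close>,
also \<open>\<bar>f (v n)\<bar> \<le> p n (w n)\<close>. A linear functional \<open>g n\<close> below \<open>p n\<close> with \<open>g n (w n) = p n (w n)\<close>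
reduces the claim to \<open>weakly_null_diagonal\<close>.\<close>

lemma disjoint_dominated_weakly_null:
  fixes v w :: "nat \<Rightarrow> 'a::banach_lattice"
  assumes v0: "\<And>n. 0 \<le> v n" and disj: "\<And>m n. m \<noteq> n \<Longrightarrow> inf (v m) (v n) = 0"
    and dom: "\<And>n. v n \<le> \<bar>w n\<bar>" and lim: "limitin weak_topology w l sequentially"
  shows "limitin weak_topology v 0 sequentially"
  unfolding limitin_weak_topology_iff
proof (intro allI impI)
  fix f :: "'a \<Rightarrow> real" assume f: "bounded_linear f"
  note lin = bounded_linear.linear[OF f]
  obtain B where B: "0 \<le> B" "\<And>x. \<bar>f x\<bar> \<le> B * norm x"
    using bounded_linear.nonneg_bounded[OF f] by (auto simp: mult.commute)
  define E where "E n x = {y. \<bar>y\<bar> \<le> \<bar>x\<bar> \<and> (\<exists>k\<ge>0. \<bar>y\<bar> \<le> k *\<^sub>R v n)}" for n and x :: 'a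
  define p where "p n x = (SUP y\<in>E n x. f y)" for n x
  have zeroE: "0 \<in> E n x" for n x by (auto simp: E_def intro: exI[of _ 0])
  have f_le: "f y \<le> B * norm x" if "y \<in> E n x" for y n x
  proof -
    have "norm y \<le> norm x" using that by (auto simp: E_def intro: norm_abs_mono)
    then have "B * norm y \<le> B * norm x" using B(1) by (rule mult_left_mono)
    then show ?thesis using B(2)[of y] by simp
  qed
  have p_ge: "f y \<le> p n x" if "y \<in> E n x" for y n x
    unfolding p_def using that f_le by (intro cSUP_upper bdd_aboveI2[of _ _ "B * norm x"]) auto
  have p_le: "p n x \<le> c" if "\<And>y. y \<in> E n x \<Longrightarrow> f y \<le> c" for n x c
    unfolding p_def using that zeroE by (intro cSUP_least) auto
  have sub: "sublinear (p n)" for n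
  proof (rule sublinearI)
    fix x x'
    show "p n (x + x') \<le> p n x + p n x'"
    proof (rule p_le)
      fix y assume "y \<in> E n (x + x')"
      then obtain k where k: "0 \<le> k" "\<bar>y\<bar> \<le> k *\<^sub>R v n" and y: "\<bar>y\<bar> \<le> \<bar>x + x'\<bar>"
        by (auto simp: E_def)
      have "\<bar>y\<bar> \<le> \<bar>x\<bar> + \<bar>x'\<bar>" using y abs_triangle_ineq by (rule order_trans)
      then obtain y1 y2 where y12: "y = y1 + y2" "\<bar>y1\<bar> \<le> \<bar>x\<bar>" "\<bar>y2\<bar> \<le> \<bar>x'\<bar>" "\<bar>y1\<bar> \<le> \<bar>y\<bar>" "\<bar>y2\<bar> \<le> \<bar>y\<bar>"
        by (rule Riesz_decomposition) auto
      then have "y1 \<in> E n x" "y2 \<in> E n x'"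
        using k by (auto simp: E_def intro: order_trans)
      then show "f y \<le> p n x + p n x'"
        using p_ge[of y1 n x] p_ge[of y2 n x'] by (simp add: y12(1) linear_add[OF lin])
    qed
  next
    show "p n 0 = 0"
    proof (rule antisym)
      show "p n 0 \<le> 0" by (rule p_le) (auto simp: E_def linear_0[OF lin])
      show "0 \<le> p n 0" using p_ge[OF zeroE] by (simp add: linear_0[OF lin])
    qed
  next
    fix a :: real and x assume a: "0 < a"
    show "p n (a *\<^sub>R x) \<le> a * p n x"
    proof (rule p_le)
      fix y assume "y \<in> E n (a *\<^sub>R x)"
      then obtain k where k: "0 \<le> k" "\<bar>y\<bar> \<le> k *\<^sub>R v n" and y: "\<bar>y\<bar> \<le> a *\<^sub>R \<bar>x\<bar>"
        using a by (auto simp: E_def abs_scaleR_nonneg)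
      have "\<bar>(1 / a) *\<^sub>R y\<bar> \<le> (1 / a) *\<^sub>R (k *\<^sub>R v n)" "\<bar>(1 / a) *\<^sub>R y\<bar> \<le> (1 / a) *\<^sub>R (a *\<^sub>R \<bar>x\<bar>)"
        using a k(2) y unfolding abs_scaleR_nonneg[of "1 / a" y, OF less_imp_le[OF divide_pos_pos[OF zero_less_one a]]]
        by (auto intro!: scaleR_left_mono simp del: scaleR_scaleR)
      then have "\<bar>(1 / a) *\<^sub>R y\<bar> \<le> (k / a) *\<^sub>R v n" "\<bar>(1 / a) *\<^sub>R y\<bar> \<le> \<bar>x\<bar>" "0 \<le> k / a"
        using a k(1) by auto
      then have "(1 / a) *\<^sub>R y \<in> E n x" by (auto simp: E_def)
      from p_ge[OF this] show "f y \<le> a * p n x"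
        using a by (simp add: linear_scale[OF lin] field_simps)
    qed
  qed
  have p_minus: "p n (- x) = p n x" for n x by (simp add: p_def E_def)
  have "\<exists>g. linear g \<and> (\<forall>x. g x \<le> p n x) \<and> g (w n) = p n (w n)" for n
    using hahn_banach_sublinear[OF sub[of n], of "w n"] by metis
  then obtain g where g: "\<And>n. linear (g n)" "\<And>n x. g n x \<le> p n x" "\<And>n. g n (w n) = p n (w n)"
    by metis
  have g_abs: "\<bar>g n x\<bar> \<le> p n x" for n x
    by (rule linear_dominated_abs[OF g(1,2) p_minus])
  have sum_p: "(\<Sum>m<n. p m x) \<le> B * norm x" for n x
  proof (rule field_le_epsilon)
    fix e :: real assume e: "0 < e"
    have "\<exists>y\<in>E m x. p m x - e / Suc n \<le> f y" for m
    proof (rule ccontr)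
      assume "\<not> ?thesis"
      then have "p m x \<le> p m x - e / Suc n" by (intro p_le) (auto simp: not_le intro: less_imp_le)
      moreover have "0 < e / Suc n" using e by simp
      ultimately show False by linarith
    qed
    then obtain y where y: "\<And>m. y m \<in> E m x" "\<And>m. p m x - e / Suc n \<le> f (y m)" by metis
    have "\<exists>k\<ge>0. \<bar>y m\<bar> \<le> k *\<^sub>R v m" for m using y(1)[of m] by (auto simp: E_def)
    then obtain k where k: "\<And>m. 0 \<le> k m" "\<And>m. \<bar>y m\<bar> \<le> k m *\<^sub>R v m" by metis
    have "(\<Sum>m<n. \<bar>y m\<bar>) \<le> \<bar>x\<bar>"
    proof (rule disjoint_sum_le)
      fix i j :: nat assume "i \<noteq> j"
      from disjoint_scaleR[OF disj[OF this] k(1)[of i] k(1)[of j]]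
      show "inf \<bar>y i\<bar> \<bar>y j\<bar> = 0" by (rule disjoint_mono) (auto simp: k(2))
    qed (use y(1) in \<open>auto simp: E_def\<close>)
    then have "\<bar>\<Sum>m<n. y m\<bar> \<le> \<bar>x\<bar>" using sum_abs by (rule order_trans[rotated])
    then have "norm (\<Sum>m<n. y m) \<le> norm x" by (rule norm_abs_mono)
    then have "B * norm (\<Sum>m<n. y m) \<le> B * norm x" using B(1) by (rule mult_left_mono)
    moreover have "(\<Sum>m<n. f (y m)) \<le> B * norm (\<Sum>m<n. y m)"
      using B(2)[of "\<Sum>m<n. y m"] by (simp add: linear_sum[OF lin])
    moreover have "(\<Sum>m<n. p m x) \<le> (\<Sum>m<n. f (y m) + e / Suc n)"
      using y(2) by (intro sum_mono) (simp add: algebra_simps)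
    moreover have "(\<Sum>m<n. e / Suc n) \<le> e" using e by (simp add: field_simps)
    ultimately show "(\<Sum>m<n. p m x) \<le> B * norm x + e" by (simp add: sum.distrib)
  qed
  have "(\<lambda>n. g n (w n)) \<longlonglongrightarrow> 0"
  proof (rule weakly_null_diagonal[OF g(1) _ lim])
    show "(\<Sum>m<n. \<bar>g m x\<bar>) \<le> B * norm x" for n x
      using sum_mono[of "{..<n}" "\<lambda>m. \<bar>g m x\<bar>" "\<lambda>m. p m x"] g_abs sum_p[of x n] by auto
  qed
  moreover have "\<bar>f (v n)\<bar> \<le> g n (w n)" for n
  proof -
    have "v n \<in> E n (w n)" "- v n \<in> E n (w n)"
      using v0[of n] dom[of n] by (auto simp: E_def abs_of_nonneg intro!: exI[of _ 1])
    from p_ge[OF this(1)] p_ge[OF this(2)] show ?thesis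
      by (auto simp: g(3) linear_neg[OF lin])
  qed
  ultimately have "(\<lambda>n. f (v n)) \<longlonglongrightarrow> 0"
    by (intro Lim_null_comparison[of "\<lambda>n. f (v n)" "\<lambda>n. g n (w n)"]) auto
  then show "(\<lambda>n. f (v n)) \<longlonglongrightarrow> f 0" by (simp add: linear_0[OF lin])
qed

definition disjoint_positive_Schur_property :: "'a::banach_lattice itself \<Rightarrow> bool" where
  "disjoint_positive_Schur_property _ \<longleftrightarrow>
     (\<forall>v :: nat \<Rightarrow> 'a. (\<forall>n. 0 \<le> v n) \<and> (\<forall>m n. m \<noteq> n \<longrightarrow> inf (v m) (v n) = 0) \<and>
        limitin weak_topology v 0 sequentially \<longrightarrow> (\<lambda>n. norm (v n)) \<longlonglongrightarrow> 0)"

text \<open>If no \<open>u\<close> works, choose \<open>w n\<close> in \<open>W\<close> with \<open>norm (pprt (\<bar>w n\<bar> - U n)) > e\<close>, where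
\<open>U n = 4 ^ n (\<Sum>i<n. \<bar>w i\<bar>)\<close>; after passing to a subsequence, \<open>w\<close> converges weakly. Put
\<open>s = (\<Sum>i. 2 ^ (- i) \<bar>w i\<bar>)\<close>. The elements \<open>v n = pprt (\<bar>w n\<bar> - U n - 2 ^ (- n) s)\<close> are disjoint: for
\<open>m < n\<close> the element \<open>v n\<close> is below \<open>pprt (\<bar>w n\<bar> - 4 ^ n \<bar>w m\<bar>)\<close>, while \<open>v m\<close> is below a multiple of
\<open>pprt (4 ^ n \<bar>w m\<bar> - \<bar>w n\<bar>)\<close>. Subtracting \<open>2 ^ (- n) s\<close> changes norms by an amount tending to \<open>0\<close>, so
the norms of \<open>v n\<close> stay away from \<open>0\<close>. But \<open>v\<close> is weakly null by \<open>disjoint_dominated_weakly_null\<close>, so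
this contradicts the disjoint Schur property.\<close>

theorem relatively_weakly_compact_almost_order_bounded:
  fixes W :: "'a::banach_lattice set"
  assumes D: "disjoint_positive_Schur_property TYPE('a)"
    and W: "relatively_weakly_compact W" and e: "0 < e"
  shows "\<exists>u\<ge>0. \<forall>w\<in>W. norm (pprt (\<bar>w\<bar> - u)) \<le> e"
proof (rule ccontr)
  assume "\<not> ?thesis"
  then have ex: "\<exists>w\<in>W. e < norm (pprt (\<bar>w\<bar> - u))" if "0 \<le> u" for u
    using that by (auto simp: not_le)
  \<comment> \<open>The second component accumulates the sum of the moduli of the members chosen before.\<close>
  have "\<exists>t. \<forall>n. (case t n of (w, s) \<Rightarrow> w \<in> W \<and> 0 \<le> s \<and> (n = 0 \<longrightarrow> s = 0) \<and>
            e < norm (pprt (\<bar>w\<bar> - 4 ^ n *\<^sub>R s))) \<and>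
          (case t n of (w, s) \<Rightarrow> case t (Suc n) of (w', s') \<Rightarrow> s' = s + \<bar>w\<bar>)"
  proof (rule dependent_nat_choice)
    show "\<exists>t. case t of (w, s) \<Rightarrow> w \<in> W \<and> 0 \<le> s \<and> (0 = (0::nat) \<longrightarrow> s = 0) \<and>
            e < norm (pprt (\<bar>w\<bar> - 4 ^ 0 *\<^sub>R s))"
      using ex[of 0] by auto
  next
    fix t :: "'a \<times> 'a" and n
    assume "case t of (w, s) \<Rightarrow> w \<in> W \<and> 0 \<le> s \<and> (n = 0 \<longrightarrow> s = 0) \<and>
            e < norm (pprt (\<bar>w\<bar> - 4 ^ n *\<^sub>R s))"
    then obtain w s where t: "t = (w, s)" "0 \<le> s" by (cases t) auto
    then have s': "0 \<le> s + \<bar>w\<bar>" by simp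
    then have "0 \<le> 4 ^ Suc n *\<^sub>R (s + \<bar>w\<bar>)" by (intro scaleR_nonneg_nonneg) auto
    from ex[OF this] obtain w' where "w' \<in> W" "e < norm (pprt (\<bar>w'\<bar> - 4 ^ Suc n *\<^sub>R (s + \<bar>w\<bar>)))"
      by blast
    with s' show "\<exists>t'. (case t' of (w, s) \<Rightarrow> w \<in> W \<and> 0 \<le> s \<and> (Suc n = 0 \<longrightarrow> s = 0) \<and>
            e < norm (pprt (\<bar>w\<bar> - 4 ^ Suc n *\<^sub>R s))) \<and>
          (case t of (w, s) \<Rightarrow> case t' of (w', s') \<Rightarrow> s' = s + \<bar>w\<bar>)"
      unfolding t by (intro exI[of _ "(w', s + \<bar>w\<bar>)"]) auto
  qed
  then obtain t where t: "\<And>n. (case t n of (w, s) \<Rightarrow> w \<in> W \<and> 0 \<le> s \<and> (n = 0 \<longrightarrow> s = 0) \<and>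
            e < norm (pprt (\<bar>w\<bar> - 4 ^ n *\<^sub>R s))) \<and>
          (case t n of (w, s) \<Rightarrow> case t (Suc n) of (w', s') \<Rightarrow> s' = s + \<bar>w\<bar>)"
    by blast
  define z where "z n = fst (t n)" for n
  have s0: "snd (t 0) = 0" using t[of 0] by (auto simp: case_prod_beta)
  have sSuc: "snd (t (Suc n)) = snd (t n) + \<bar>z n\<bar>" for n
    using t[of n] by (auto simp: z_def case_prod_beta)
  have s: "snd (t n) = (\<Sum>i<n. \<bar>z i\<bar>)" for n
    by (induction n) (simp_all add: s0 sSuc)
  have zW: "z n \<in> W" and z: "e < norm (pprt (\<bar>z n\<bar> - 4 ^ n *\<^sub>R (\<Sum>i<n. \<bar>z i\<bar>)))" for n
    using t[of n] by (auto simp: case_prod_beta z_def simp flip: s[unfolded z_def])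
  obtain l and r :: "nat \<Rightarrow> nat" where r: "strict_mono r"
    and l: "limitin weak_topology (\<lambda>n. z (r n)) l sequentially"
    by (rule relatively_weakly_compact_subsequence[where z = z, OF W zW])
  define w where "w n = z (r n)" for n
  have lim: "limitin weak_topology w l sequentially" using l by (simp add: w_def[abs_def])
  define U where "U n = 4 ^ n *\<^sub>R (\<Sum>i<n. \<bar>w i\<bar>)" for n
  have U0: "0 \<le> U n" for n
    unfolding U_def by (intro scaleR_nonneg_nonneg sum_nonneg) auto
  \<comment> \<open>Passing to a subsequence only decreases the element that is subtracted.\<close>
  have w: "e < norm (pprt (\<bar>w n\<bar> - U n))" for n
  proof -
    have "(\<Sum>i<n. \<bar>w i\<bar>) = (\<Sum>j\<in>r ` {..<n}. \<bar>z j\<bar>)"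
      unfolding w_def using r by (subst sum.reindex) (auto simp: strict_mono_imp_inj_on)
    also have "\<dots> \<le> (\<Sum>j<r n. \<bar>z j\<bar>)"
      using r by (intro sum_mono2) (auto simp: strict_mono_def)
    finally have "(\<Sum>i<n. \<bar>w i\<bar>) \<le> (\<Sum>j<r n. \<bar>z j\<bar>)" .
    moreover have "(4 :: real) ^ n \<le> 4 ^ r n"
      using r by (intro power_increasing seq_suble) auto
    ultimately have "U n \<le> 4 ^ r n *\<^sub>R (\<Sum>j<r n. \<bar>z j\<bar>)"
      unfolding U_def by (intro scaleR_mono) (auto intro: sum_nonneg)
    then have "pprt (\<bar>z (r n)\<bar> - 4 ^ r n *\<^sub>R (\<Sum>j<r n. \<bar>z j\<bar>)) \<le> pprt (\<bar>w n\<bar> - U n)"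
      unfolding w_def by (intro pprt_mono diff_left_mono)
    then have "norm (pprt (\<bar>z (r n)\<bar> - 4 ^ r n *\<^sub>R (\<Sum>j<r n. \<bar>z j\<bar>))) \<le> norm (pprt (\<bar>w n\<bar> - U n))"
      by (rule norm_mono_nonneg[OF zero_le_pprt])
    then show ?thesis using z[of "r n"] by simp
  qed
  obtain C where C: "\<And>n. norm (w n) \<le> C"
    using relatively_weakly_compact_imp_bounded[OF W] zW unfolding bounded_iff w_def by blast
  have summ: "summable (\<lambda>n. (1 / 2) ^ n *\<^sub>R \<bar>w n\<bar>)"
  proof (rule summable_comparison_test')
    show "summable (\<lambda>n. (1 / 2 :: real) ^ n * C)" by (intro summable_mult2 summable_geometric) simp
    show "norm ((1 / 2) ^ n *\<^sub>R \<bar>w n\<bar>) \<le> (1 / 2) ^ n * C" for n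
      using C by (auto intro: mult_left_mono)
  qed
  define s where "s = (\<Sum>n. (1 / 2) ^ n *\<^sub>R \<bar>w n\<bar>)"
  have term_nonneg: "0 \<le> (1 / 2) ^ n *\<^sub>R \<bar>w n\<bar>" for n by (intro scaleR_nonneg_nonneg) auto
  have term_le: "(1 / 2) ^ n *\<^sub>R \<bar>w n\<bar> \<le> s" for n
  proof (rule lim_mono_lattice)
    show "(\<lambda>m. (1 / 2) ^ n *\<^sub>R \<bar>w n\<bar>) \<longlonglongrightarrow> (1 / 2) ^ n *\<^sub>R \<bar>w n\<bar>" by simp
    show "(\<lambda>m. \<Sum>i<m + Suc n. (1 / 2) ^ i *\<^sub>R \<bar>w i\<bar>) \<longlonglongrightarrow> s"
      unfolding s_def by (intro LIMSEQ_ignore_initial_segment summable_LIMSEQ summ)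
    show "(1 / 2) ^ n *\<^sub>R \<bar>w n\<bar> \<le> (\<Sum>i<m + Suc n. (1 / 2) ^ i *\<^sub>R \<bar>w i\<bar>)" for m
      by (rule nonneg_member_le_sum[of n _ "\<lambda>i. (1 / 2) ^ i *\<^sub>R \<bar>w i\<bar>"]) (use term_nonneg in auto)
  qed
  have s_nonneg: "0 \<le> s" using term_nonneg term_le by (rule order_trans)
  define v where "v n = pprt (\<bar>w n\<bar> - U n - (1 / 2) ^ n *\<^sub>R s)" for n
  have s_scaled: "0 \<le> (1 / 2) ^ n *\<^sub>R s" for n using s_nonneg by (intro scaleR_nonneg_nonneg) auto
  have v0: "0 \<le> v n" for n by (simp add: v_def)
  have disj_less: "inf (v m) (v n) = 0" if "m < n" for m n
  proof -
    have "4 ^ n *\<^sub>R \<bar>w m\<bar> \<le> U n"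
      unfolding U_def using nonneg_member_le_sum[of m "{..<n}" "\<lambda>i. \<bar>w i\<bar>"] that
      by (intro scaleR_left_mono) auto
    then have "4 ^ n *\<^sub>R \<bar>w m\<bar> \<le> U n + (1 / 2) ^ n *\<^sub>R s" using s_scaled by (rule add_increasing2[rotated])
    then have vn: "v n \<le> pprt (\<bar>w n\<bar> - 4 ^ n *\<^sub>R \<bar>w m\<bar>)"
      unfolding v_def by (intro pprt_mono) (simp add: algebra_simps)
    have "(1 / 4) ^ n *\<^sub>R \<bar>w n\<bar> = (1 / 2) ^ n *\<^sub>R ((1 / 2) ^ n *\<^sub>R \<bar>w n\<bar>)"
      by (simp flip: power_mult_distrib)
    also have "\<dots> \<le> (1 / 2) ^ m *\<^sub>R s"
      using that term_le s_nonneg term_nonneg by (intro scaleR_mono power_decreasing) auto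
    also have "\<dots> \<le> U m + (1 / 2) ^ m *\<^sub>R s" using U0 by simp
    finally have "v m \<le> pprt (\<bar>w m\<bar> - (1 / 4) ^ n *\<^sub>R \<bar>w n\<bar>)"
      unfolding v_def by (intro pprt_mono) (simp add: algebra_simps)
    also have "\<bar>w m\<bar> - (1 / 4) ^ n *\<^sub>R \<bar>w n\<bar> = (1 / 4) ^ n *\<^sub>R (4 ^ n *\<^sub>R \<bar>w m\<bar> - \<bar>w n\<bar>)"
      by (simp add: scaleR_diff_right flip: power_mult_distrib)
    also have "pprt \<dots> = (1 / 4) ^ n *\<^sub>R pprt (4 ^ n *\<^sub>R \<bar>w m\<bar> - \<bar>w n\<bar>)"
      by (simp add: scaleR_pprt)
    finally have vm: "v m \<le> (1 / 4) ^ n *\<^sub>R pprt (4 ^ n *\<^sub>R \<bar>w m\<bar> - \<bar>w n\<bar>)" .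
    have "inf ((1 / 4) ^ n *\<^sub>R pprt (4 ^ n *\<^sub>R \<bar>w m\<bar> - \<bar>w n\<bar>)) (1 *\<^sub>R pprt (\<bar>w n\<bar> - 4 ^ n *\<^sub>R \<bar>w m\<bar>)) = 0"
      by (rule disjoint_scaleR[OF pprt_diff_disjoint]) auto
    then show ?thesis using vn vm v0 by (intro disjoint_mono[of "(1 / 4) ^ n *\<^sub>R pprt (4 ^ n *\<^sub>R \<bar>w m\<bar> - \<bar>w n\<bar>)"
          "pprt (\<bar>w n\<bar> - 4 ^ n *\<^sub>R \<bar>w m\<bar>)" "v m" "v n"]) auto
  qed
  have disj: "inf (v m) (v n) = 0" if "m \<noteq> n" for m n
    using that disj_less[of m n] disj_less[of n m] by (cases "m < n") (auto simp: inf_commute)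
  have dom: "v n \<le> \<bar>w n\<bar>" for n
  proof -
    have "0 \<le> U n + (1 / 2) ^ n *\<^sub>R s" using U0 s_scaled by (rule add_nonneg_nonneg)
    then have "\<bar>w n\<bar> - U n - (1 / 2) ^ n *\<^sub>R s \<le> \<bar>w n\<bar>" by (simp add: algebra_simps)
    then show ?thesis unfolding v_def pprt_def by simp
  qed
  have "limitin weak_topology v 0 sequentially"
    by (rule disjoint_dominated_weakly_null[OF v0 disj dom lim])
  then have "(\<lambda>n. norm (v n)) \<longlonglongrightarrow> 0"
    using D v0 disj by (auto simp: disjoint_positive_Schur_property_def)
  then have "(\<lambda>n. norm (v n) + (1 / 2) ^ n * norm s) \<longlonglongrightarrow> 0 + 0 * norm s"
    by (intro tendsto_intros LIMSEQ_realpow_zero) auto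
  moreover have "e \<le> norm (v n) + (1 / 2) ^ n * norm s" for n
  proof -
    have "norm (pprt (\<bar>w n\<bar> - U n)) \<le> norm (v n + (1 / 2) ^ n *\<^sub>R s)"
      using pprt_le_pprt_diff_add[OF s_scaled, of "\<bar>w n\<bar> - U n" n]
      by (intro norm_mono_nonneg) (auto simp: v_def)
    also have "\<dots> \<le> norm (v n) + (1 / 2) ^ n * norm s"
      using norm_triangle_ineq[of "v n" "(1 / 2) ^ n *\<^sub>R s"] by simp
    finally show ?thesis using w[of n] by simp
  qed
  ultimately have "e \<le> 0" by (intro LIMSEQ_le_const) auto
  then show False using e by simp
qed

section \<open>Consequences of norm null order bounded sums\<close>

definition order_bounded_sums_null :: "'a::banach_lattice itself \<Rightarrow> bool" where
  "order_bounded_sums_null _ \<longleftrightarrow>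
     (\<forall>(y :: nat \<Rightarrow> 'a) u. (\<forall>n. 0 \<le> y n) \<and> (\<forall>n. (\<Sum>i<n. y i) \<le> u) \<longrightarrow>
        (\<lambda>n. norm (y n)) \<longlonglongrightarrow> 0)"

lemma order_bounded_sums_nullD:
  fixes y :: "nat \<Rightarrow> 'a::banach_lattice"
  assumes "order_bounded_sums_null TYPE('a)" "\<And>n. 0 \<le> y n" "\<And>n. (\<Sum>i<n. y i) \<le> u"
  shows "(\<lambda>n. norm (y n)) \<longlonglongrightarrow> 0"
  using assms unfolding order_bounded_sums_null_def by blast

text \<open>Otherwise \<open>D\<close> contains a decreasing sequence whose successive differences have norm at least \<open>e\<close>; the
partial sums of these differences are bounded by the first element.\<close>

lemma small_decrements:
  fixes D :: "'a::banach_lattice set"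
  assumes P: "order_bounded_sums_null TYPE('a)" and D: "D \<noteq> {}" "\<And>d. d \<in> D \<Longrightarrow> 0 \<le> d"
    and e: "0 < e"
  shows "\<exists>d\<in>D. \<forall>d'\<in>D. d' \<le> d \<longrightarrow> norm (d - d') < e"
proof (rule ccontr)
  assume "\<not> ?thesis"
  then have step: "\<exists>d'\<in>D. d' \<le> d \<and> e \<le> norm (d - d')" if "d \<in> D" for d
    using that by (auto simp: not_less)
  have "\<exists>d. \<forall>n. d n \<in> D \<and> (d (Suc n) \<le> d n \<and> e \<le> norm (d n - d (Suc n)))"
    by (rule dependent_nat_choice) (use D(1) step in blast)+
  then obtain d where d: "\<And>n. d n \<in> D" "\<And>n. d (Suc n) \<le> d n" "\<And>n. e \<le> norm (d n - d (Suc n))"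
    by blast
  have "(\<lambda>n. norm (d n - d (Suc n))) \<longlonglongrightarrow> 0"
  proof (rule order_bounded_sums_nullD[OF P, of _ "d 0"])
    show "0 \<le> d n - d (Suc n)" for n using d(2) by simp
    show "(\<Sum>i<n. d i - d (Suc i)) \<le> d 0" for n
      using D(2)[OF d(1)[of n]] by (simp add: sum_lessThan_telescope')
  qed
  then have "e \<le> 0" using d(3) by (intro LIMSEQ_le_const) auto
  then show False using e by simp
qed

lemma incseq_bounded_convergent:
  fixes s :: "nat \<Rightarrow> 'a::banach_lattice"
  assumes P: "order_bounded_sums_null TYPE('a)" and s: "\<And>n. s n \<le> s (Suc n)" "\<And>n. s n \<le> u"
  shows "convergent s"
proof -
  have mono: "s m \<le> s n" if "m \<le> n" for m n using s(1) that by (rule lift_Suc_mono_le)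
  have "Cauchy s"
  proof (rule metric_CauchyI)
    fix e :: real assume "0 < e"
    then obtain d where "d \<in> range (\<lambda>n. u - s n)"
      and d: "\<And>d'. d' \<in> range (\<lambda>n. u - s n) \<Longrightarrow> d' \<le> d \<Longrightarrow> norm (d - d') < e / 2"
      using small_decrements[OF P, of "range (\<lambda>n. u - s n)" "e / 2"] s(2) by fastforce
    then obtain N where N: "d = u - s N" by blast
    have near: "dist (s n) (s N) < e / 2" if "n \<ge> N" for n
      using d[of "u - s n"] mono[OF that] by (simp add: N dist_norm)
    have "dist (s m) (s n) < e" if "m \<ge> N" "n \<ge> N" for m n
      using near[OF that(1)] near[OF that(2)] by (rule dist_triangle_half_l)
    then show "\<exists>N. \<forall>m\<ge>N. \<forall>n\<ge>N. dist (s m) (s n) < e" by blast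
  qed
  then show ?thesis by (rule Cauchy_convergent)
qed

text \<open>A decreasing sequence \<open>d\<close> in the directed set \<open>D\<close> of values of \<open>z\<close>, chosen so that below \<open>d n\<close> the set \<open>D\<close>
varies by less than \<open>1 / (n + 1)\<close> in norm, converges in norm to a lower bound of \<open>D\<close>: given \<open>a\<close> in \<open>D\<close>,
the same limit is approached by elements of \<open>D\<close> below \<open>a\<close>. So the limit is \<open>0\<close>.\<close>

theorem net_decreasing_to_zero_norm:
  fixes z :: "'j \<Rightarrow> 'a::banach_lattice"
  assumes P: "order_bounded_sums_null TYPE('a)" and z: "net_decreases_to_zero J le z" and e: "0 < e"
  shows "\<exists>b\<in>J. norm (z b) < e"
proof -
  define D where "D = z ` J"
  have D0: "D \<noteq> {}" and Dpos: "\<And>d. d \<in> D \<Longrightarrow> 0 \<le> d"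
    and Dinf: "\<And>w. (\<And>d. d \<in> D \<Longrightarrow> w \<le> d) \<Longrightarrow> w \<le> 0"
    using z by (auto simp: D_def net_decreases_to_zero_def directed_set_def)
  have Ddir: "\<exists>c\<in>D. c \<le> a \<and> c \<le> b" if ab: "a \<in> D" "b \<in> D" for a b
  proof -
    obtain i j where "i \<in> J" "j \<in> J" "a = z i" "b = z j" using ab by (auto simp: D_def)
    moreover then obtain k where "k \<in> J" "le i k" "le j k"
      using z unfolding net_decreases_to_zero_def directed_set_def by blast
    ultimately show ?thesis using z by (auto simp: D_def net_decreases_to_zero_def)
  qed
  define good where "good n d \<longleftrightarrow> d \<in> D \<and> (\<forall>d'\<in>D. d' \<le> d \<longrightarrow> norm (d - d') < 1 / Suc n)" for n d
  have good_below: "\<exists>c. good n c \<and> c \<le> d" if d: "d \<in> D" for n d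
  proof -
    obtain a where a: "a \<in> D" "\<And>d'. d' \<in> D \<Longrightarrow> d' \<le> a \<Longrightarrow> norm (a - d') < 1 / Suc n"
      using small_decrements[OF P D0 Dpos, of "1 / Suc n"] by auto
    obtain c where c: "c \<in> D" "c \<le> a" "c \<le> d" using Ddir[OF a(1) d] by blast
    have "norm (c - d') < 1 / Suc n" if "d' \<in> D" "d' \<le> c" for d'
    proof -
      have "norm (c - d') \<le> norm (a - d')" using that c(2) by (intro norm_mono_nonneg) auto
      also have "\<dots> < 1 / Suc n" using that c(2) by (intro a(2)) auto
      finally show ?thesis .
    qed
    then show ?thesis using c by (auto simp: good_def)
  qed
  have "\<exists>d. \<forall>n. good n (d n) \<and> d (Suc n) \<le> d n"
  proof (rule dependent_nat_choice)
    show "\<exists>d. good 0 d" using D0 good_below by blast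
    show "\<exists>c. good (Suc n) c \<and> c \<le> d" if "good n d" for d n
      using that by (intro good_below) (simp add: good_def)
  qed
  then obtain d where d: "\<And>n. good n (d n)" "\<And>n. d (Suc n) \<le> d n" by blast
  have dD: "d n \<in> D" for n using d(1)[of n] by (simp add: good_def)
  have "convergent (\<lambda>n. - d n)"
    using d(2) Dpos[OF dD] by (intro incseq_bounded_convergent[OF P, of _ 0]) auto
  then have "convergent d" using convergent_minus_iff by blast
  then obtain L where L: "d \<longlonglongrightarrow> L" by (auto simp: convergent_def)
  have "L \<le> a" if a: "a \<in> D" for a
  proof -
    obtain c where c: "\<And>n. c n \<in> D" "\<And>n. c n \<le> a" "\<And>n. c n \<le> d n"
      using Ddir[OF a dD] by metis
    have "(\<lambda>n. d n - c n) \<longlonglongrightarrow> 0"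
    proof (rule Lim_null_comparison)
      show "\<forall>\<^sub>F n in sequentially. norm (d n - c n) \<le> 1 / Suc n"
        using d(1) c by (auto simp: good_def intro!: always_eventually less_imp_le)
      show "(\<lambda>n. 1 / Suc n) \<longlonglongrightarrow> 0" using LIMSEQ_inverse_real_of_nat by (simp add: inverse_eq_divide)
    qed
    from tendsto_diff[OF L this] have "c \<longlonglongrightarrow> L" by simp
    then show ?thesis using c(2) by (rule lim_mono_lattice[OF _ tendsto_const])
  qed
  then have "L \<le> 0" by (rule Dinf)
  moreover have "0 \<le> L" using L Dpos[OF dD] by (rule lim_nonneg)
  ultimately have "(\<lambda>n. norm (d n)) \<longlonglongrightarrow> 0" using L tendsto_norm_zero by force
  then have "\<forall>\<^sub>F n in sequentially. norm (d n) < e" using e by (rule order_tendstoD)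
  then obtain n where "norm (d n) < e" by (auto simp: eventually_sequentially)
  then show ?thesis using dD[of n] by (auto simp: D_def)
qed

text \<open>A linear functional below \<open>x \<mapsto> norm (pprt x)\<close> is positive, since its value at \<open>- x\<close> is at most \<open>0\<close> for
\<open>x \<ge> 0\<close>.\<close>

lemma positive_norming_functional_exists:
  fixes v :: "'a::banach_lattice"
  assumes v: "0 \<le> v"
  shows "\<exists>g :: 'a \<Rightarrow> real. bounded_linear g \<and> (\<forall>x\<ge>0. 0 \<le> g x) \<and> (\<forall>x. \<bar>g x\<bar> \<le> norm x) \<and> g v = norm v"
proof -
  let ?p = "\<lambda>x :: 'a. norm (pprt x)"
  have sub: "sublinear ?p"
  proof (rule sublinearI)
    fix x y :: 'a
    have "x + y \<le> pprt x + pprt y" by (intro add_mono) (auto simp: pprt_def)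
    then have "pprt (x + y) \<le> pprt x + pprt y" unfolding pprt_def[of "x + y"] by simp
    then have "?p (x + y) \<le> norm (pprt x + pprt y)" by (intro norm_mono_nonneg) auto
    also have "\<dots> \<le> ?p x + ?p y" by (rule norm_triangle_ineq)
    finally show "?p (x + y) \<le> ?p x + ?p y" .
  qed (simp_all flip: scaleR_pprt)
  obtain g where g: "linear g" "\<And>x. g x \<le> ?p x" "g v = ?p v"
    using hahn_banach_sublinear[OF sub] by blast
  have p_le: "?p x \<le> norm x" for x
  proof -
    have "pprt x \<le> \<bar>x\<bar>" by (simp add: pprt_def abs_ge_self)
    then have "?p x \<le> norm \<bar>x\<bar>" by (intro norm_mono_nonneg) auto
    then show ?thesis by simp
  qed
  have abs: "\<bar>g x\<bar> \<le> norm x" for x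
    using g(2)[of x] g(2)[of "- x"] p_le[of x] p_le[of "- x"] linear_neg[OF g(1), of x] by simp
  have "0 \<le> g x" if "0 \<le> x" for x
    using g(2)[of "- x"] that linear_neg[OF g(1), of x] by simp
  moreover have "bounded_linear g" by (rule bounded_linear_of_norm_bound[OF g(1), of 1]) (simp add: abs)
  ultimately show ?thesis using abs g(3) v by auto
qed

primrec partial_sup :: "(nat \<Rightarrow> 'a::semilattice_sup) \<Rightarrow> nat \<Rightarrow> 'a" where
  "partial_sup z 0 = z 0"
| "partial_sup z (Suc m) = sup (partial_sup z m) (z (Suc m))"

lemma partial_sup_upper: "j \<le> m \<Longrightarrow> z j \<le> partial_sup z m"
  by (induction m) (auto simp: le_Suc_eq intro: le_supI1)

lemma partial_sup_least: "(\<And>j. j \<le> m \<Longrightarrow> z j \<le> u) \<Longrightarrow> partial_sup z m \<le> u"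
  by (induction m) auto

text \<open>Suppose that the norms stay above \<open>e\<close> along a subsequence, and let \<open>\<phi> n\<close> be a positive norming
functional of \<open>x n\<close>. As every \<open>\<phi> i\<close> tends to \<open>0\<close> along \<open>x\<close>, there is a further subsequence \<open>z\<close> such
that the norming functional of \<open>z k\<close> takes values with sum at most \<open>e / 2\<close> on all later members of \<open>z\<close>.
Their suprema exist as norm limits, because increasing order bounded sequences converge; let \<open>L k\<close> be the
supremum of \<open>z j\<close> over \<open>j \<ge> k\<close>. The norming functional of \<open>z k\<close> is at least \<open>e\<close> at \<open>L k\<close>, which
dominates \<open>z k\<close>, and at most \<open>e / 2\<close> at \<open>L (k + 1)\<close>. So the differences \<open>L k - L (k + 1)\<close> have norm at least
\<open>e / 2\<close>, while their partial sums are bounded by \<open>L 0\<close>, a contradiction.\<close>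

theorem order_bounded_positively_null_imp_norm_null:
  fixes x :: "nat \<Rightarrow> 'a::banach_lattice"
  assumes P: "order_bounded_sums_null TYPE('a)" and x: "\<And>n. 0 \<le> x n" "\<And>n. x n \<le> u"
    and null: "\<And>g :: 'a \<Rightarrow> real. bounded_linear g \<Longrightarrow> (\<And>y. 0 \<le> y \<Longrightarrow> 0 \<le> g y) \<Longrightarrow> (\<lambda>n. g (x n)) \<longlonglongrightarrow> 0"
  shows "(\<lambda>n. norm (x n)) \<longlonglongrightarrow> 0"
proof (rule ccontr)
  assume "\<not> (\<lambda>n. norm (x n)) \<longlonglongrightarrow> 0"
  then obtain e and r :: "nat \<Rightarrow> nat" where e: "0 < e" and r: "strict_mono r"
    and far: "\<And>n. e \<le> norm (x (r n))"
    using not_tendsto_subseq[of "\<lambda>n. norm (x n)" 0] by auto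
  have "\<exists>g :: 'a \<Rightarrow> real. bounded_linear g \<and> (\<forall>y\<ge>0. 0 \<le> g y) \<and> (\<forall>y. \<bar>g y\<bar> \<le> norm y) \<and> g (x n) = norm (x n)" for n
    by (rule positive_norming_functional_exists[OF x(1)])
  then obtain \<phi> :: "nat \<Rightarrow> 'a \<Rightarrow> real" where \<phi>: "\<And>n. bounded_linear (\<phi> n)"
    "\<And>n y. 0 \<le> y \<Longrightarrow> 0 \<le> \<phi> n y" "\<And>n y. \<bar>\<phi> n y\<bar> \<le> norm y" "\<And>n. \<phi> n (x n) = norm (x n)"
    by metis
  note \<phi>_lin = bounded_linear.linear[OF \<phi>(1)]
  have \<phi>_mono: "\<phi> n a \<le> \<phi> n b" if "a \<le> b" for n a b
    using \<phi>(2)[of "b - a" n] that by (simp add: linear_diff[OF \<phi>_lin])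
  have "\<exists>p. \<forall>k. e \<le> norm (x (p k)) \<and>
      (p k < p (Suc k) \<and> (\<forall>i\<le>p k. \<phi> i (x (p (Suc k))) < e / 2 * (1 / 2) ^ Suc k))"
  proof (rule dependent_nat_choice)
    show "\<exists>p. e \<le> norm (x p)" using far by blast
  next
    fix p k :: nat
    have "\<forall>\<^sub>F n in sequentially. \<forall>i\<in>{..p}. \<phi> i (x n) < e / 2 * (1 / 2) ^ Suc k"
    proof (intro eventually_ball_finite ballI)
      fix i
      show "\<forall>\<^sub>F n in sequentially. \<phi> i (x n) < e / 2 * (1 / 2) ^ Suc k"
        using e by (intro order_tendstoD(2)[OF null[OF \<phi>(1,2)]]) auto
    qed simp
    then obtain N where N: "\<And>n. n \<ge> N \<Longrightarrow> \<forall>i\<in>{..p}. \<phi> i (x n) < e / 2 * (1 / 2) ^ Suc k"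
      unfolding eventually_sequentially by blast
    let ?n = "r (max N (Suc p))"
    have "?n \<ge> max N (Suc p)" using r by (rule seq_suble)
    then show "\<exists>n. e \<le> norm (x n) \<and> (p < n \<and> (\<forall>i\<le>p. \<phi> i (x n) < e / 2 * (1 / 2) ^ Suc k))"
      using far N[of ?n] by (intro exI[of _ ?n]) auto
  qed
  then obtain p where p: "\<And>k. e \<le> norm (x (p k))" "\<And>k. p k < p (Suc k)"
    "\<And>k i. i \<le> p k \<Longrightarrow> \<phi> i (x (p (Suc k))) < e / 2 * (1 / 2) ^ Suc k"
    by blast
  have p_mono: "p j \<le> p k" if "j \<le> k" for j k
    by (rule lift_Suc_mono_le[of p, OF less_imp_le[OF p(2)] that])
  define z where "z k = x (p k)" for k
  define S where "S k m = partial_sup (\<lambda>j. z (k + j)) m" for k m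
  have S_le: "S k m \<le> u" for k m unfolding S_def by (rule partial_sup_least) (simp add: z_def x)
  have "convergent (S k)" for k
    by (rule incseq_bounded_convergent[OF P _ S_le]) (simp add: S_def)
  then obtain L where L: "\<And>k. S k \<longlonglongrightarrow> L k" unfolding convergent_def by metis
  have z_le: "z k \<le> L k" for k
  proof (rule lim_mono_lattice[OF tendsto_const L])
    show "z k \<le> S k m" for m
      using partial_sup_upper[of 0 m "\<lambda>j. z (k + j)"] by (simp add: S_def)
  qed
  have L_nonneg: "0 \<le> L k" for k
    using x(1)[of "p k"] unfolding z_def[symmetric] by (rule order_trans[OF _ z_le])
  have L_le: "L k \<le> u" for k by (rule lim_mono_lattice[OF L tendsto_const S_le])
  have L_dec: "L (Suc k) \<le> L k" for k
  proof (rule lim_mono_lattice[OF L LIMSEQ_Suc[OF L]])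
    show "S (Suc k) m \<le> S k (Suc m)" for m
      unfolding S_def
    proof (rule partial_sup_least)
      fix j assume "j \<le> m"
      then show "z (Suc k + j) \<le> partial_sup (\<lambda>j. z (k + j)) (Suc m)"
        using partial_sup_upper[of "Suc j" "Suc m" "\<lambda>j. z (k + j)"] by simp
    qed
  qed
  have "e / 2 \<le> norm (L k - L (Suc k))" for k
  proof -
    have "\<phi> (p k) (S (Suc k) m) \<le> e / 2" for m
    proof -
      have "S (Suc k) m \<le> (\<Sum>j\<le>m. z (Suc k + j))"
        unfolding S_def
        by (rule partial_sup_least, rule nonneg_member_le_sum[of _ _ "\<lambda>j. z (Suc k + j)"])
          (auto simp: z_def x)
      then have "\<phi> (p k) (S (Suc k) m) \<le> (\<Sum>j\<le>m. \<phi> (p k) (z (Suc k + j)))"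
        using \<phi>_mono by (simp flip: linear_sum[OF \<phi>_lin])
      also have "\<dots> \<le> (\<Sum>j\<le>m. e / 2 * (1 / 2) ^ Suc j)"
      proof (rule sum_mono)
        fix j
        have "\<phi> (p k) (z (Suc k + j)) < e / 2 * (1 / 2) ^ Suc (k + j)"
          using p(3)[of "p k" "k + j"] p_mono[of k "k + j"] by (simp add: z_def)
        also have "\<dots> \<le> e / 2 * (1 / 2) ^ Suc j"
          using e by (intro mult_left_mono power_decreasing) auto
        finally show "\<phi> (p k) (z (Suc k + j)) \<le> e / 2 * (1 / 2) ^ Suc j" by simp
      qed
      also have "\<dots> = e / 2 * (\<Sum>j\<le>m. (1 / 2) ^ Suc j)" by (rule sum_distrib_left[symmetric])
      also have "\<dots> \<le> e / 2 * 1"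
      proof (rule mult_left_mono)
        have "(\<Sum>j\<le>m. (1 / 2 :: real) ^ Suc j) \<le> (\<Sum>j. (1 / 2) ^ Suc j)"
          using power_half_series by (intro sum_le_suminf) (auto simp: sums_iff)
        then show "(\<Sum>j\<le>m. (1 / 2 :: real) ^ Suc j) \<le> 1"
          using power_half_series by (simp add: sums_iff)
      qed (use e in simp)
      finally show ?thesis by simp
    qed
    moreover have "(\<lambda>m. \<phi> (p k) (S (Suc k) m)) \<longlonglongrightarrow> \<phi> (p k) (L (Suc k))"
      by (rule bounded_linear.tendsto[OF \<phi>(1) L])
    ultimately have "\<phi> (p k) (L (Suc k)) \<le> e / 2" by (intro LIMSEQ_le_const2) auto
    moreover have "e \<le> \<phi> (p k) (z k)" using p(1)[of k] \<phi>(4) by (simp add: z_def)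
    moreover have "\<phi> (p k) (z k) \<le> \<phi> (p k) (L k)" using z_le by (rule \<phi>_mono)
    ultimately have "e / 2 \<le> \<phi> (p k) (L k - L (Suc k))" by (simp add: linear_diff[OF \<phi>_lin])
    also have "\<dots> \<le> norm (L k - L (Suc k))" using \<phi>(3)[of "p k" "L k - L (Suc k)"] by simp
    finally show ?thesis .
  qed
  moreover have "(\<lambda>k. norm (L k - L (Suc k))) \<longlonglongrightarrow> 0"
  proof (rule order_bounded_sums_nullD[OF P, of _ "L 0"])
    show "0 \<le> L k - L (Suc k)" for k using L_dec by simp
    show "(\<Sum>i<n. L i - L (Suc i)) \<le> L 0" for n
      using L_nonneg[of n] by (simp add: sum_lessThan_telescope')
  qed
  ultimately have "e / 2 \<le> 0" by (intro LIMSEQ_le_const) auto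
  then show False using e by simp
qed

lemma norm_le_pprt_diff_add_norm_inf:
  fixes a u :: "'a::banach_lattice"
  shows "norm a \<le> norm (pprt (a - u)) + norm (inf a u)"
  using norm_triangle_ineq[of "pprt (a - u)" "inf a u"] unfolding pprt_diff diff_add_cancel .

section \<open>From the two sequence properties to Schur properties\<close>

text \<open>Almost order boundedness reduces the claim to the truncations \<open>inf (x n) u\<close>. Their weak convergence to
\<open>0\<close> is only clear for positive functionals, by domination, but no more is required in an order interval.\<close>

theorem positive_Schur_from_disjoint:
  assumes P: "order_bounded_sums_null TYPE('a::banach_lattice)"
    and D: "disjoint_positive_Schur_property TYPE('a)"
  shows "positive_Schur_property TYPE('a)"
  unfolding positive_Schur_property_def
proof (intro allI impI)
  fix x :: "nat \<Rightarrow> 'a"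
  assume "(\<forall>n. 0 \<le> x n) \<and> limitin weak_topology x 0 sequentially"
  then have x: "\<And>n. 0 \<le> x n" and lim: "limitin weak_topology x 0 sequentially" by auto
  show "(\<lambda>n. norm (x n)) \<longlonglongrightarrow> 0"
  proof (rule order_tendstoI)
    fix e :: real assume "0 < e"
    then obtain u where u: "0 \<le> u" "\<And>n. norm (pprt (\<bar>x n\<bar> - u)) \<le> e / 2"
      using relatively_weakly_compact_almost_order_bounded[OF D relatively_weakly_compact_range[OF lim], of "e / 2"]
      by auto
    have "(\<lambda>n. norm (inf (x n) u)) \<longlonglongrightarrow> 0"
    proof (rule order_bounded_positively_null_imp_norm_null[OF P, of _ u])
      fix g :: "'a \<Rightarrow> real" assume g: "bounded_linear g" "\<And>y. 0 \<le> y \<Longrightarrow> 0 \<le> g y"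
      note lin = bounded_linear.linear[OF g(1)]
      have gx: "(\<lambda>n. g (x n)) \<longlonglongrightarrow> 0"
        using lim g(1) linear_0[OF lin] by (fastforce simp: limitin_weak_topology_iff)
      have lower: "0 \<le> g (inf (x n) u)" for n using x u(1) by (intro g(2)) simp
      have upper: "g (inf (x n) u) \<le> g (x n)" for n
      proof -
        have "0 \<le> x n - inf (x n) u" unfolding diff_ge_0_iff_ge by (rule inf_le1)
        from g(2)[OF this] show ?thesis unfolding linear_diff[OF lin] by linarith
      qed
      show "(\<lambda>n. g (inf (x n) u)) \<longlonglongrightarrow> 0"
        by (rule tendsto_sandwich[OF _ _ tendsto_const gx]; rule always_eventually; rule allI; rule lower upper)
    qed (use x u(1) in auto)
    then have "\<forall>\<^sub>F n in sequentially. norm (inf (x n) u) < e / 2"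
      using \<open>0 < e\<close> by (intro order_tendstoD) auto
    then show "\<forall>\<^sub>F n in sequentially. norm (x n) < e"
    proof (rule eventually_mono)
      fix n assume "norm (inf (x n) u) < e / 2"
      then show "norm (x n) < e"
        using u(2)[of n] norm_le_pprt_diff_add_norm_inf[of "x n" u] x[of n] by (simp add: abs_of_nonneg)
    qed
  next
    fix e :: real assume "e < 0"
    then show "\<forall>\<^sub>F n in sequentially. e < norm (x n)"
      by (intro always_eventually) (auto intro: less_le_trans)
  qed
qed

theorem uo_convergent_net_norm_convergent:
  fixes x :: "'i \<Rightarrow> 'a::banach_lattice"
  assumes P: "order_bounded_sums_null TYPE('a)"
    and D: "disjoint_positive_Schur_property TYPE('a)"
    and I: "directed_set I le" and W: "relatively_weakly_compact (x ` I)"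
    and uo: "uo_converges I le x l"
  shows "((\<lambda>i. norm (x i - l)) \<longlongrightarrow> 0) (net_filter I le)"
proof (rule order_tendstoI)
  fix e :: real assume e: "0 < e"
  then obtain u where u: "0 \<le> u" "\<And>i. i \<in> I \<Longrightarrow> norm (pprt (\<bar>x i\<bar> - u)) \<le> e / 2"
    using relatively_weakly_compact_almost_order_bounded[OF D W, of "e / 2"] by auto
  define U where "U = u + \<bar>l\<bar>"
  have U: "0 \<le> U" using u(1) by (simp add: U_def)
  have outside: "norm (pprt (\<bar>x i - l\<bar> - U)) \<le> e / 2" if "i \<in> I" for i
  proof -
    have "\<bar>x i - l\<bar> - U \<le> \<bar>x i\<bar> - u"
      using abs_triangle_ineq4[of "x i" l] by (simp add: U_def algebra_simps)
    then have "norm (pprt (\<bar>x i - l\<bar> - U)) \<le> norm (pprt (\<bar>x i\<bar> - u))"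
      by (intro norm_mono_nonneg pprt_mono) auto
    then show ?thesis using u(2)[OF that] by simp
  qed
  have "order_converges I le (\<lambda>i. inf \<bar>x i - l\<bar> U) 0"
    using uo U by (simp add: uo_converges_def)
  then obtain J :: "'a set" and leJ z where z: "net_decreases_to_zero J leJ z"
    and dom: "\<forall>b\<in>J. \<exists>i0\<in>I. \<forall>i\<in>I. le i0 i \<longrightarrow> \<bar>inf \<bar>x i - l\<bar> U - 0\<bar> \<le> z b"
    unfolding order_converges_def by blast
  obtain b where b: "b \<in> J" "norm (z b) < e / 2"
    using net_decreasing_to_zero_norm[OF P z, of "e / 2"] e by auto
  then obtain i0 where i0: "i0 \<in> I" "\<And>i. i \<in> I \<Longrightarrow> le i0 i \<Longrightarrow> \<bar>inf \<bar>x i - l\<bar> U\<bar> \<le> z b"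
    using dom by auto
  have "norm (x i - l) < e" if i: "i \<in> I" "le i0 i" for i
  proof -
    have "norm (inf \<bar>x i - l\<bar> U) \<le> norm (z b)"
      using i0(2)[OF i] by (intro norm_abs_mono) (auto intro: order_trans abs_ge_self)
    then show ?thesis
      using norm_le_pprt_diff_add_norm_inf[of "\<bar>x i - l\<bar>" U] outside[OF i(1)] b(2) by simp
  qed
  then show "\<forall>\<^sub>F i in net_filter I le. norm (x i - l) < e"
    using i0(1) unfolding eventually_net_filter[OF I] by blast
next
  fix e :: real assume "e < 0"
  then show "\<forall>\<^sub>F i in net_filter I le. e < norm (x i - l)"
    by (intro always_eventually) (auto intro: less_le_trans)
qed

section \<open>Bounded sums and disjoint sequences in order complete lattices\<close>

text \<open>For a functional \<open>f\<close>, flip the sign of those \<open>y i\<close> at which \<open>f\<close> is negative. The sums remain in the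
order interval \<open>{- u..u}\<close>, so the series of the \<open>\<bar>f (y i)\<bar>\<close> has bounded partial sums.\<close>

lemma order_bounded_sums_weakly_null:
  fixes y :: "nat \<Rightarrow> 'a::banach_lattice"
  assumes y: "\<And>n. 0 \<le> y n" "\<And>n. (\<Sum>i<n. y i) \<le> u"
  shows "limitin weak_topology y 0 sequentially"
  unfolding limitin_weak_topology_iff
proof (intro allI impI)
  fix f :: "'a \<Rightarrow> real" assume f: "bounded_linear f"
  note lin = bounded_linear.linear[OF f]
  obtain B where B: "0 \<le> B" "\<And>x. \<bar>f x\<bar> \<le> B * norm x"
    using bounded_linear.nonneg_bounded[OF f] by (auto simp: mult.commute)
  have "(\<Sum>i<n. \<bar>f (y i)\<bar>) \<le> B * norm u" for n
  proof -
    define c where "c i = (if 0 \<le> f (y i) then y i else - y i)" for i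
    have c: "\<bar>c i\<bar> = y i" "f (c i) = \<bar>f (y i)\<bar>" for i
      using y(1)[of i] by (auto simp: c_def abs_of_nonneg linear_neg[OF lin])
    have "\<bar>\<Sum>i<n. c i\<bar> \<le> (\<Sum>i<n. y i)"
      using sum_abs[of c "{..<n}"] by (simp add: c)
    also have "\<dots> \<le> u" by (rule y(2))
    also have "\<dots> \<le> \<bar>u\<bar>" by (rule abs_ge_self)
    finally have "norm (\<Sum>i<n. c i) \<le> norm u" by (rule norm_abs_mono)
    then have "B * norm (\<Sum>i<n. c i) \<le> B * norm u" using B(1) by (rule mult_left_mono)
    moreover have "(\<Sum>i<n. \<bar>f (y i)\<bar>) = f (\<Sum>i<n. c i)"
      by (simp add: linear_sum[OF lin] c)
    ultimately show ?thesis using B(2)[of "\<Sum>i<n. c i"] by linarith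
  qed
  then have "summable (\<lambda>n. \<bar>f (y n)\<bar>)"
    by (intro bounded_imp_summable[of _ "B * norm u"])
      (auto simp: lessThan_Suc_atMost[symmetric] simp del: sum.lessThan_Suc)
  then have "(\<lambda>n. \<bar>f (y n)\<bar>) \<longlonglongrightarrow> 0" by (rule summable_LIMSEQ_zero)
  then show "(\<lambda>n. f (y n)) \<longlonglongrightarrow> f 0"
    unfolding linear_0[OF lin] by (rule tendsto_rabs_zero_cancel)
qed

text \<open>With \<open>s\<close> the supremum of the partial sums, \<open>y n\<close> is dominated by the remainders \<open>s - (\<Sum>i<k. y i)\<close> for
\<open>k \<le> n\<close>, and these decrease to \<open>0\<close>.\<close>

lemma order_bounded_sums_order_null:
  fixes y :: "nat \<Rightarrow> 'a::banach_lattice"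
  assumes complete: "sigma_order_complete TYPE('a)"
    and y: "\<And>n. 0 \<le> y n" "\<And>n. (\<Sum>i<n. y i) \<le> u"
  shows "order_converges UNIV (\<le>) y 0"
proof -
  let ?A = "range (\<lambda>n. \<Sum>i<n. y i)"
  have "countable ?A \<and> ?A \<noteq> {} \<and> bdd_above ?A"
    using y(2) by (auto intro!: bdd_aboveI[of _ u])
  then obtain s where s: "\<forall>a\<in>?A. a \<le> s" "\<forall>t. (\<forall>a\<in>?A. a \<le> t) \<longrightarrow> s \<le> t"
    using complete unfolding sigma_order_complete_def by blast
  have sum_le: "(\<Sum>i<n. y i) \<le> s" for n using s(1) by blast
  define z where "z k = s - (\<Sum>i<k. y i)" for k
  show ?thesis
  proof (rule order_convergesI)
    show "net_decreases_to_zero (UNIV :: nat set) (\<le>) z"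
      unfolding net_decreases_to_zero_def
    proof (intro conjI ballI allI impI directed_set_nat)
      fix b c :: nat assume "b \<le> c"
      then show "z c \<le> z b"
        unfolding z_def using y(1) by (intro diff_left_mono sum_mono2) auto
    next
      show "0 \<le> z b" for b using sum_le[of b] by (simp add: z_def)
    next
      fix w assume w: "\<forall>b\<in>UNIV. w \<le> z b"
      have "(\<Sum>i<k. y i) \<le> s - w" for k
        using w by (auto simp: z_def algebra_simps)
      then have "s \<le> s - w" using s(2) by blast
      then show "w \<le> 0" by simp
    qed
  next
    fix b :: nat
    have "\<bar>y i - 0\<bar> \<le> z b" if "b \<le> i" for i
    proof -
      have "(\<Sum>j<b. y j) + y i \<le> (\<Sum>j<i. y j) + y i"
        using that y(1) by (intro add_right_mono sum_mono2) auto
      also have "\<dots> \<le> s" using sum_le[of "Suc i"] by simp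
      finally show ?thesis using y(1)[of i] by (simp add: z_def abs_of_nonneg algebra_simps)
    qed
    then show "\<exists>i0\<in>UNIV. \<forall>i\<in>UNIV. i0 \<le> i \<longrightarrow> \<bar>y i - 0\<bar> \<le> z b" by blast
  qed
qed

lemma uo_null_of_bounded_truncated_sums:
  fixes y :: "nat \<Rightarrow> 'a::banach_lattice"
  assumes complete: "sigma_order_complete TYPE('a)" and y: "\<And>n. 0 \<le> y n"
    and sums: "\<And>v. 0 \<le> v \<Longrightarrow> \<exists>u. \<forall>n. (\<Sum>i<n. inf (y i) v) \<le> u"
  shows "uo_converges_seq y 0"
  unfolding uo_converges_def
proof (intro allI impI)
  fix v :: 'a assume v: "0 \<le> v"
  then obtain u where u: "\<And>n. (\<Sum>i<n. inf (y i) v) \<le> u" using sums by blast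
  have "order_converges UNIV (\<le>) (\<lambda>i. inf (y i) v) 0"
    using y v by (intro order_bounded_sums_order_null[OF complete _ u]) auto
  moreover have "\<bar>y i - 0\<bar> = y i" for i using y[of i] by (simp add: abs_of_nonneg)
  ultimately show "order_converges UNIV (\<le>) (\<lambda>i. inf \<bar>y i - 0\<bar> v) 0" by simp
qed

text \<open>Both kinds of sequences have truncations with order bounded partial sums: the truncations inherit a bound
on the partial sums, and for a disjoint sequence the sum of the truncations at \<open>u\<close> is their supremum, which
is at most \<open>u\<close>.\<close>

theorem uo_Schur_imp_sums_null_and_disjoint_Schur:
  assumes complete: "sigma_order_complete TYPE('a::banach_lattice)"
    and uo_Schur: "\<And>x :: nat \<Rightarrow> 'a. (\<And>n. 0 \<le> x n) \<Longrightarrow> limitin weak_topology x 0 sequentially \<Longrightarrow>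
      uo_converges_seq x 0 \<Longrightarrow> (\<lambda>n. norm (x n)) \<longlonglongrightarrow> 0"
  shows "order_bounded_sums_null TYPE('a)" and "disjoint_positive_Schur_property TYPE('a)"
proof -
  show "order_bounded_sums_null TYPE('a)"
    unfolding order_bounded_sums_null_def
  proof (intro allI impI)
    fix y :: "nat \<Rightarrow> 'a" and u
    assume "(\<forall>n. 0 \<le> y n) \<and> (\<forall>n. (\<Sum>i<n. y i) \<le> u)"
    then have y: "\<And>n. 0 \<le> y n" "\<And>n. (\<Sum>i<n. y i) \<le> u" by auto
    show "(\<lambda>n. norm (y n)) \<longlonglongrightarrow> 0"
    proof (rule uo_Schur[OF y(1) order_bounded_sums_weakly_null[OF y]])
      show "uo_converges_seq y 0"
      proof (rule uo_null_of_bounded_truncated_sums[OF complete y(1)])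
        fix v :: 'a
        have "(\<Sum>i<n. inf (y i) v) \<le> u" for n
          using y(2)[of n] by (intro order_trans[OF sum_mono[of "{..<n}" "\<lambda>i. inf (y i) v" y]]) auto
        then show "\<exists>u. \<forall>n. (\<Sum>i<n. inf (y i) v) \<le> u" by blast
      qed
    qed
  qed
  show "disjoint_positive_Schur_property TYPE('a)"
    unfolding disjoint_positive_Schur_property_def
  proof (intro allI impI)
    fix v :: "nat \<Rightarrow> 'a"
    assume "(\<forall>n. 0 \<le> v n) \<and> (\<forall>m n. m \<noteq> n \<longrightarrow> inf (v m) (v n) = 0) \<and>
        limitin weak_topology v 0 sequentially"
    then have v: "\<And>n. 0 \<le> v n" and disj: "\<And>m n. m \<noteq> n \<Longrightarrow> inf (v m) (v n) = 0"
      and lim: "limitin weak_topology v 0 sequentially" by auto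
    show "(\<lambda>n. norm (v n)) \<longlonglongrightarrow> 0"
    proof (rule uo_Schur[OF v lim], rule uo_null_of_bounded_truncated_sums[OF complete v])
      fix u :: 'a assume u: "0 \<le> u"
      have "(\<Sum>i<n. inf (v i) u) \<le> u" for n
      proof (rule disjoint_sum_le)
        fix i j :: nat assume "i \<noteq> j"
        from disj[OF this] show "inf (inf (v i) u) (inf (v j) u) = 0"
          by (rule disjoint_mono) (use v u in auto)
      qed (use v u in auto)
      then show "\<exists>b. \<forall>n. (\<Sum>i<n. inf (v i) u) \<le> b" by blast
    qed
  qed
qed

section \<open>Nets, and the equivalence\<close>

text \<open>If the net were not norm null, \<open>0\<close> would be in the weak closure of those members whose norm is at least \<open>e\<close>,
hence the weak limit of a sequence of such members.\<close>

theorem positive_Schur_net: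
  fixes x :: "'i \<Rightarrow> 'a::banach_lattice"
  assumes Schur: "positive_Schur_property TYPE('a)" and I: "directed_set I le"
    and W: "relatively_weakly_compact (x ` I)" and x: "\<And>i. i \<in> I \<Longrightarrow> 0 \<le> x i"
    and lim: "limitin weak_topology x 0 (net_filter I le)"
  shows "((\<lambda>i. norm (x i)) \<longlongrightarrow> 0) (net_filter I le)"
proof (rule order_tendstoI)
  fix e :: real assume e: "0 < e"
  show "\<forall>\<^sub>F i in net_filter I le. norm (x i) < e"
  proof (rule ccontr)
    assume "\<not> ?thesis"
    then have frequently: "\<exists>i\<in>I. le i0 i \<and> e \<le> norm (x i)" if "i0 \<in> I" for i0
      using that unfolding eventually_net_filter[OF I] by (auto simp: not_less)
    define A where "A = {x i |i. i \<in> I \<and> e \<le> norm (x i)}"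
    have "0 \<in> weak_topology closure_of A"
      unfolding in_closure_of
    proof (intro conjI allI impI)
      fix T :: "'a set" assume "0 \<in> T \<and> openin weak_topology T"
      then have "\<forall>\<^sub>F i in net_filter I le. x i \<in> T" using lim by (auto simp: limitin_def)
      then obtain i0 where "i0 \<in> I" "\<And>i. i \<in> I \<Longrightarrow> le i0 i \<Longrightarrow> x i \<in> T"
        unfolding eventually_net_filter[OF I] by blast
      moreover then obtain i where "i \<in> I" "le i0 i" "e \<le> norm (x i)" using frequently by blast
      ultimately show "\<exists>y. y \<in> A \<and> y \<in> T" by (auto simp: A_def)
    qed simp
    moreover have "A \<subseteq> x ` I" by (auto simp: A_def)
    ultimately obtain z where z: "\<And>k. z k \<in> A" "limitin weak_topology z 0 sequentially"
      using weak_closure_sequence[OF W, of "\<lambda>k. A" 0] by blast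
    have "0 \<le> z k" "e \<le> norm (z k)" for k using z(1)[of k] x by (auto simp: A_def)
    moreover then have "(\<lambda>k. norm (z k)) \<longlonglongrightarrow> 0"
      using Schur z(2) by (auto simp: positive_Schur_property_def)
    ultimately have "e \<le> 0" by (intro LIMSEQ_le_const) auto
    then show False using e by simp
  qed
next
  fix e :: real assume "e < 0"
  then show "\<forall>\<^sub>F i in net_filter I le. e < norm (x i)"
    by (intro always_eventually) (auto intro: less_le_trans)
qed

text \<open>A copy of the natural numbers inside \<open>'i\<close>, so that sequences become nets over \<open>'i\<close> by composing with \<open>\<rho>\<close>.\<close>

lemma sequence_index_in_infinite_type:
  assumes "infinite (UNIV :: 'i set)"
  shows "\<exists>(I :: 'i set) le (\<rho> :: 'i \<Rightarrow> nat). directed_set I le \<and> \<rho> ` I = UNIV \<and>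
    (\<forall>i j. le i j \<longleftrightarrow> \<rho> i \<le> \<rho> j) \<and> filtermap \<rho> (net_filter I le) = sequentially"
proof -
  obtain e :: "nat \<Rightarrow> 'i" where e: "inj e" using infinite_countable_subset[OF assms] by blast
  define \<rho> where "\<rho> = inv e"
  define le where "le i j \<longleftrightarrow> \<rho> i \<le> \<rho> j" for i j
  have \<rho>e: "\<rho> (e n) = n" for n using e by (simp add: \<rho>_def)
  have "directed_set (range e) le"
    unfolding directed_set_def
  proof (intro conjI ballI)
    fix i j
    have "le i (e (max (\<rho> i) (\<rho> j)))" "le j (e (max (\<rho> i) (\<rho> j)))" by (auto simp: le_def \<rho>e)
    then show "\<exists>k\<in>range e. le i k \<and> le j k" by blast
  qed (auto simp: le_def reflp_on_def transp_on_def)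
  moreover from this have "filtermap \<rho> (net_filter (range e) le) = sequentially"
    unfolding filter_eq_iff eventually_filtermap eventually_sequentially
    by (auto simp: eventually_net_filter le_def \<rho>e)
  moreover have "\<rho> ` range e = UNIV" by (auto simp: image_image \<rho>e)
  ultimately show ?thesis
    by (intro exI[of _ "range e"] exI[of _ le] exI[of _ \<rho>]) (simp add: le_def)
qed

lemma uo_converges_reindex:
  fixes x :: "nat \<Rightarrow> 'a::lattice_ab_group_add_abs"
  assumes \<rho>: "\<rho> ` I = UNIV" "\<And>i j. le i j \<longleftrightarrow> \<rho> i \<le> \<rho> j" and uo: "uo_converges_seq x l"
  shows "uo_converges I le (\<lambda>i. x (\<rho> i)) l"
proof -
  have tail: "\<exists>i0\<in>I. \<forall>i\<in>I. le i0 i \<longrightarrow> P (\<rho> i)"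
    if ex: "\<exists>n0\<in>UNIV. \<forall>n\<in>UNIV. n0 \<le> n \<longrightarrow> P n" for P :: "nat \<Rightarrow> bool"
  proof -
    obtain n0 where n0: "\<forall>n. n0 \<le> n \<longrightarrow> P n" using ex by blast
    have "n0 \<in> \<rho> ` I" using \<rho>(1) by simp
    then obtain i0 where "i0 \<in> I" "n0 = \<rho> i0" by blast
    then show ?thesis using n0 \<rho>(2) by auto
  qed
  have "order_converges I le (\<lambda>i. y (\<rho> i)) 0" if y: "order_converges UNIV (\<le>) y 0"
    for y :: "nat \<Rightarrow> 'a"
  proof -
    obtain J :: "'a set" and leJ z where "net_decreases_to_zero J leJ z"
      and dom: "\<And>b. b \<in> J \<Longrightarrow> \<exists>n0\<in>UNIV. \<forall>n\<in>UNIV. n0 \<le> n \<longrightarrow> \<bar>y n - 0\<bar> \<le> z b"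
      using y unfolding order_converges_def by auto
    then show ?thesis
      by (intro order_convergesI[of J leJ z] tail[of "\<lambda>n. \<bar>y n - 0\<bar> \<le> z _"])
  qed
  note reindex = this
  show ?thesis
    unfolding uo_converges_def
  proof (intro allI impI)
    fix v :: 'a assume "0 \<le> v"
    then have "order_converges UNIV (\<le>) (\<lambda>n. inf \<bar>x n - l\<bar> v) 0"
      using uo by (simp add: uo_converges_def)
    from reindex[OF this] show "order_converges I le (\<lambda>i. inf \<bar>x (\<rho> i) - l\<bar> v) 0" .
  qed
qed

theorem theorem3p11:
  assumes index_type: "infinite (UNIV :: 'i set)"
    and complete: "sigma_order_complete TYPE('a::banach_lattice)"
  shows
    "(positive_Schur_property TYPE('a) \<longleftrightarrow>
       (\<forall>(I :: 'i set) le (x :: 'i \<Rightarrow> 'a).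
          directed_set I le \<and> relatively_weakly_compact (x ` I) \<and> (\<forall>i\<in>I. 0 \<le> x i) \<and>
          limitin weak_topology x 0 (net_filter I le) \<longrightarrow>
          ((\<lambda>i. norm (x i)) \<longlongrightarrow> 0) (net_filter I le))) \<and>
     (positive_Schur_property TYPE('a) \<longleftrightarrow>
       (\<forall>(x :: nat \<Rightarrow> 'a) l.
          limitin weak_topology x l sequentially \<and> uo_converges_seq x l \<longrightarrow>
          (\<lambda>n. norm (x n - l)) \<longlonglongrightarrow> 0)) \<and>
     (positive_Schur_property TYPE('a) \<longleftrightarrow>
       (\<forall>(I :: 'i set) le (x :: 'i \<Rightarrow> 'a) l.
          directed_set I le \<and> relatively_weakly_compact (x ` I) \<and> uo_converges I le x l \<longrightarrow>
          ((\<lambda>i. norm (x i - l)) \<longlongrightarrow> 0) (net_filter I le))) \<and>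
     (positive_Schur_property TYPE('a) \<longleftrightarrow>
       (\<forall>x :: nat \<Rightarrow> 'a.
          (\<forall>n. 0 \<le> x n) \<and> limitin weak_topology x 0 sequentially \<and> uo_converges_seq x 0 \<longrightarrow>
          (\<lambda>n. norm (x n)) \<longlonglongrightarrow> 0)) \<and>
     (positive_Schur_property TYPE('a) \<longleftrightarrow>
       (\<forall>(I :: 'i set) le (x :: 'i \<Rightarrow> 'a).
          directed_set I le \<and> relatively_weakly_compact (x ` I) \<and> (\<forall>i\<in>I. 0 \<le> x i) \<and>
          uo_converges I le x 0 \<longrightarrow>
          ((\<lambda>i. norm (x i)) \<longlongrightarrow> 0) (net_filter I le)))"
    (is "(?S1 \<longleftrightarrow> ?S2) \<and> (?S1 \<longleftrightarrow> ?S3) \<and> (?S1 \<longleftrightarrow> ?S4) \<and> (?S1 \<longleftrightarrow> ?S5) \<and> (?S1 \<longleftrightarrow> ?S6)")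
proof -
  obtain I :: "'i set" and le and \<rho> :: "'i \<Rightarrow> nat" where I: "directed_set I le"
    and \<rho>: "\<rho> ` I = UNIV" "\<And>i j. le i j \<longleftrightarrow> \<rho> i \<le> \<rho> j" "filtermap \<rho> (net_filter I le) = sequentially"
    using sequence_index_in_infinite_type[OF index_type] by (elim exE conjE) auto
  have range: "(\<lambda>i. x (\<rho> i)) ` I = range x" for x :: "nat \<Rightarrow> 'a"
    using \<rho>(1) by (metis image_image)
  have weak: "limitin weak_topology (\<lambda>i. x (\<rho> i)) l (net_filter I le)"
    if "limitin weak_topology x l sequentially" for x :: "nat \<Rightarrow> 'a" and l
    using that unfolding limitin_def \<rho>(3)[symmetric] eventually_filtermap .
  have norm: "(\<lambda>n. norm (x n)) \<longlonglongrightarrow> 0"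
    if "((\<lambda>i. norm (x (\<rho> i))) \<longlongrightarrow> 0) (net_filter I le)" for x :: "nat \<Rightarrow> 'a"
    using that unfolding \<rho>(3)[symmetric] filterlim_filtermap .
  \<comment> \<open>The fifth condition is the weakest: it follows from each of the others, and the two sequence properties follow from it.\<close>
  have PD: "order_bounded_sums_null TYPE('a)" "disjoint_positive_Schur_property TYPE('a)" if ?S5
    using uo_Schur_imp_sums_null_and_disjoint_Schur[OF complete] that by blast+
  have 51: ?S1 if ?S5 using PD[OF that] by (rule positive_Schur_from_disjoint)
  have 15: ?S5 if ?S1 using that unfolding positive_Schur_property_def by blast
  have 12: ?S2 if ?S1
    using positive_Schur_net[OF that] by blast
  have 21: ?S1 if S2: ?S2
    unfolding positive_Schur_property_def
  proof (intro allI impI)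
    fix x :: "nat \<Rightarrow> 'a"
    assume x: "(\<forall>n. 0 \<le> x n) \<and> limitin weak_topology x 0 sequentially"
    then have "relatively_weakly_compact (range x)" using relatively_weakly_compact_range by blast
    with x show "(\<lambda>n. norm (x n)) \<longlonglongrightarrow> 0"
      using S2[rule_format, of I le "\<lambda>i. x (\<rho> i)"] I weak by (intro norm) (auto simp: range)
  qed
  have 14: ?S4 if ?S1
    using uo_convergent_net_norm_convergent[OF PD[OF 15[OF that]]] by blast
  have 13: ?S3 if ?S1
  proof (intro allI impI)
    fix x :: "nat \<Rightarrow> 'a" and l
    assume x: "limitin weak_topology x l sequentially \<and> uo_converges_seq x l"
    then have "relatively_weakly_compact (range x)" using relatively_weakly_compact_range by blast
    with x show "(\<lambda>n. norm (x n - l)) \<longlonglongrightarrow> 0"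
      using uo_convergent_net_norm_convergent[OF PD[OF 15[OF that]] directed_set_nat, of x l]
      by (simp add: net_filter_nat)
  qed
  have 35: ?S5 if S3: ?S3
    using S3[rule_format, of _ 0] by simp
  have 46: ?S6 if S4: ?S4
    using S4[rule_format, of _ _ _ 0] by simp
  have 65: ?S5 if S6: ?S6
  proof (intro allI impI)
    fix x :: "nat \<Rightarrow> 'a"
    assume x: "(\<forall>n. 0 \<le> x n) \<and> limitin weak_topology x 0 sequentially \<and> uo_converges_seq x 0"
    then have "relatively_weakly_compact (range x)" using relatively_weakly_compact_range by blast
    with x show "(\<lambda>n. norm (x n)) \<longlonglongrightarrow> 0"
      using S6[rule_format, of I le "\<lambda>i. x (\<rho> i)"] I uo_converges_reindex[OF \<rho>(1,2), of x 0]
      by (intro norm) (auto simp: range)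
  qed
  show ?thesis
    by (intro conjI iffI[OF 12 21] iffI[OF 13 51[OF 35]] iffI[OF 14 51[OF 65[OF 46]]]
        iffI[OF 15 51] iffI[OF 46[OF 14] 51[OF 65]])
qed

end
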